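(* Let $E$ be a monogenic geometric (a,b)-module having a unique normal sub-(a,b)-module of rank $1$. Then $E$ is a $[\lambda]$-primitive theme for some rational $\lambda\in\,]0,1]$.
   Context: $\tilde{\mathcal A}$ denotes the $\mathbb C$-algebra of formal series $\sum_{\nu\ge0}P_\nu(a)b^\nu$ ($P_\nu\in\mathbb C[z]$) with product determined by $ab-ba=b^2$ and $b$-adic continuity of left and right multiplication by $a$. An (a,b)-module is a left $\tilde{\mathcal A}$-module free of finite rank over $\mathbb C[[b]]$; it is monogenic if generated by one element as $\tilde{\mathcal A}$-module. It is regular if contained in an (a,b)-module $E'$ with $aE'\subset bE'$; then the saturation $E^\sharp$ of $E$ by $b^{-1}a$ in $E\otimes_{\mathbb C[[b]]}\mathbb C[[b]][b^{-1}]$ is finitely generated over $\mathbb C[[b]]$, and the Bernstein polynomial of $E$ is the minimal polynomial of $-b^{-1}a$ on $E^\sharp/bE^\sharp$. $E$ is geometric if it is regular and all roots of its Bernstein polynomial are negative rationals. A submodule $F\subset E$ is normal if $F\cap bE=bF$. For rational $\lambda\in]0,1]$, $\Xi_\lambda=\bigoplus_{j\ge0}\mathbb C[[b]]e_{\lambda,j}$ (finite sums; $e_{\lambda,j}$ stands for $s^{\lambda-1}(\log s)^j/j!$) with $ae_{\lambda,0}=\lambda be_{\lambda,0}$, $ae_{\lambda,j}=\lambda be_{\lambda,j}+be_{\lambda,j-1}$ ($j\ge1$), extended by $aS(b)=S(b)a+b^2S'(b)$; $\Xi=\bigoplus_{\lambda\in\mathbb Q\cap]0,1]}\Xi_\lambda$.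 A theme is a left $\tilde{\mathcal A}$-module isomorphic to $\tilde{\mathcal A}\varphi\subset\Xi$ for some $\varphi\in\Xi$. A regular (a,b)-module is $[\lambda]$-primitive if every root of its Bernstein polynomial lies in $-\lambda+\mathbb Z$. *)

theory Defs
  imports "HOL-Computational_Algebra.Computational_Algebra"
          "HOL-Computational_Algebra.Formal_Laurent_Series"
          "HOL-Library.Function_Algebras"
begin

text \<open>A space is given by an additive group 'v, a scalar multiplication sm by
  formal power series in b (b = fps_X) and the operator A (the action of a).\<close>

definition poly_op :: "(complex fps \<Rightarrow> 'v::ab_group_add \<Rightarrow> 'v) \<Rightarrow> ('v \<Rightarrow> 'v)
    \<Rightarrow> complex poly \<Rightarrow> 'v \<Rightarrow> 'v" where
  "poly_op sm A p x = (\<Sum>k\<le>degree p. sm (fps_const (coeff p k)) ((A ^^ k) x))"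

text \<open>Action of the element sum_nu P_nu(a) b^nu of A-tilde on x, as the b-adic limit
  (taken inside the carrier C) of the partial sums.\<close>
definition atilde_act :: "'v set \<Rightarrow> (complex fps \<Rightarrow> 'v::ab_group_add \<Rightarrow> 'v) \<Rightarrow> ('v \<Rightarrow> 'v)
    \<Rightarrow> (nat \<Rightarrow> complex poly) \<Rightarrow> 'v \<Rightarrow> 'v" where
  "atilde_act C sm A P x = (THE y. y \<in> C \<and> (\<forall>N. \<exists>z\<in>C.
      y - (\<Sum>\<nu><N. poly_op sm A (P \<nu>) (sm (fps_X ^ \<nu>) x)) = sm (fps_X ^ N) z))"

definition atilde_span :: "'v set \<Rightarrow> (complex fps \<Rightarrow> 'v::ab_group_add \<Rightarrow> 'v) \<Rightarrow> ('v \<Rightarrow> 'v)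
    \<Rightarrow> 'v \<Rightarrow> 'v set" where
  "atilde_span C sm A x = {atilde_act C sm A P x | P. True}"

definition free_of_rank :: "(complex fps \<Rightarrow> 'v::ab_group_add \<Rightarrow> 'v) \<Rightarrow> 'v set \<Rightarrow> nat \<Rightarrow> bool" where
  "free_of_rank sm F r \<longleftrightarrow> (\<exists>e :: nat \<Rightarrow> 'v. (\<forall>k<r. e k \<in> F)
     \<and> (\<forall>x\<in>F. \<exists>c. x = (\<Sum>k<r. sm (c k) (e k)))
     \<and> (\<forall>c. (\<Sum>k<r. sm (c k) (e k)) = 0 \<longrightarrow> (\<forall>k<r. c k = 0)))"

text \<open>F is an (a,b)-module: a C[[b]]-submodule stable under a, free of finite rank
  (the A-tilde structure is then determined by a and b).\<close>
definition is_ab_module :: "(complex fps \<Rightarrow> 'v::ab_group_add \<Rightarrow> 'v) \<Rightarrow> ('v \<Rightarrow> 'v) \<Rightarrow> 'v set \<Rightarrow> bool" where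
  "is_ab_module sm A F \<longleftrightarrow> 0 \<in> F \<and> (\<forall>x\<in>F. \<forall>y\<in>F. x + y \<in> F)
     \<and> (\<forall>S. \<forall>x\<in>F. sm S x \<in> F) \<and> (\<forall>x\<in>F. A x \<in> F) \<and> (\<exists>r. free_of_rank sm F r)"

definition fps_span :: "(complex fps \<Rightarrow> 'v::ab_group_add \<Rightarrow> 'v) \<Rightarrow> 'v set \<Rightarrow> 'v set" where
  "fps_span sm S = {y. \<exists>(n::nat) c v. (\<forall>k<n. v k \<in> S) \<and> y = (\<Sum>k<n. sm (c k) (v k))}"

text \<open>An (a,b)-module of rank n = card I is, up to isomorphism, C[[b]]^I with basis
  (e_j) and a e_j = sum_i M j i e_i; a then acts by a(S e_j) = S a e_j + b^2 S' e_j.\<close>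

definition smE :: "complex fps \<Rightarrow> ('i \<Rightarrow> complex fps) \<Rightarrow> ('i \<Rightarrow> complex fps)" where
  "smE S x = (\<lambda>i. S * x i)"

definition aE :: "('i::finite \<Rightarrow> 'i \<Rightarrow> complex fps) \<Rightarrow> ('i \<Rightarrow> complex fps) \<Rightarrow> ('i \<Rightarrow> complex fps)" where
  "aE M x = (\<lambda>i. (\<Sum>j\<in>UNIV. x j * M j i) + fps_X ^ 2 * fps_deriv (x i))"

definition monogenic :: "('i::finite \<Rightarrow> 'i \<Rightarrow> complex fps) \<Rightarrow> bool" where
  "monogenic M \<longleftrightarrow> (\<exists>x. atilde_span UNIV smE (aE M) x = UNIV)"

definition normal_sub :: "('i \<Rightarrow> complex fps) set \<Rightarrow> bool" where
  "normal_sub F \<longleftrightarrow> F \<inter> range (smE fps_X) = smE fps_X ` F"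

subsection \<open>Localisation E \<otimes> C[[b]][b^-1] = C((b))^I, saturation, Bernstein polynomial\<close>

definition liftL :: "('i \<Rightarrow> complex fps) \<Rightarrow> ('i \<Rightarrow> complex fls)" where
  "liftL x = (\<lambda>i. fps_to_fls (x i))"

definition smL :: "complex fps \<Rightarrow> ('i \<Rightarrow> complex fls) \<Rightarrow> ('i \<Rightarrow> complex fls)" where
  "smL S y = (\<lambda>i. fps_to_fls S * y i)"

definition aL :: "('i::finite \<Rightarrow> 'i \<Rightarrow> complex fps) \<Rightarrow> ('i \<Rightarrow> complex fls) \<Rightarrow> ('i \<Rightarrow> complex fls)" where
  "aL M y = (\<lambda>i. (\<Sum>j\<in>UNIV. y j * fps_to_fls (M j i)) + fls_X ^ 2 * fls_deriv (y i))"

definition binv_a :: "('i::finite \<Rightarrow> 'i \<Rightarrow> complex fps) \<Rightarrow> ('i \<Rightarrow> complex fls) \<Rightarrow> ('i \<Rightarrow> complex fls)" where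
  "binv_a M y = (\<lambda>i. fls_X_inv * aL M y i)"

definition regular :: "('i::finite \<Rightarrow> 'i \<Rightarrow> complex fps) \<Rightarrow> bool" where
  "regular M \<longleftrightarrow> (\<exists>E'. range liftL \<subseteq> E' \<and> is_ab_module smL (aL M) E'
      \<and> aL M ` E' \<subseteq> smL fps_X ` E')"

definition saturation :: "('i::finite \<Rightarrow> 'i \<Rightarrow> complex fps) \<Rightarrow> ('i \<Rightarrow> complex fls) set" where
  "saturation M = fps_span smL (\<Union>k. (binv_a M ^^ k) ` range liftL)"

definition annihilates :: "('i::finite \<Rightarrow> 'i \<Rightarrow> complex fps) \<Rightarrow> complex poly \<Rightarrow> bool" where
  "annihilates M p \<longleftrightarrow> (\<forall>y\<in>saturation M.
      poly_op smL (\<lambda>z. - binv_a M z) p y \<in> smL fps_X ` saturation M)"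

definition bernstein :: "('i::finite \<Rightarrow> 'i \<Rightarrow> complex fps) \<Rightarrow> complex poly" where
  "bernstein M = (THE p. lead_coeff p = 1 \<and> annihilates M p
      \<and> (\<forall>q. annihilates M q \<longrightarrow> p dvd q))"

definition geometric :: "('i::finite \<Rightarrow> 'i \<Rightarrow> complex fps) \<Rightarrow> bool" where
  "geometric M \<longleftrightarrow> regular M \<and>
     (\<forall>z. poly (bernstein M) z = 0 \<longrightarrow> (\<exists>q::rat. q < 0 \<and> z = of_rat q))"

definition primitive :: "('i::finite \<Rightarrow> 'i \<Rightarrow> complex fps) \<Rightarrow> rat \<Rightarrow> bool" where
  "primitive M l \<longleftrightarrow> regular M \<and>
     (\<forall>z. poly (bernstein M) z = 0 \<longrightarrow> (\<exists>k::int. z = - of_rat l + of_int k))"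

text \<open>An element of Xi is sum S_{l,j} e_{l,j}, encoded as f l j = S_{l,j}, finitely
  supported with l \<in> ]0,1] rational.\<close>
definition Xi :: "(rat \<Rightarrow> nat \<Rightarrow> complex fps) set" where
  "Xi = {f. finite {(l, j). f l j \<noteq> 0} \<and> (\<forall>l j. f l j \<noteq> 0 \<longrightarrow> 0 < l \<and> l \<le> 1)}"

definition smX :: "complex fps \<Rightarrow> (rat \<Rightarrow> nat \<Rightarrow> complex fps) \<Rightarrow> (rat \<Rightarrow> nat \<Rightarrow> complex fps)" where
  "smX S f = (\<lambda>l j. S * f l j)"

text \<open>a(sum S_{l,j} e_{l,j}) = sum S_{l,j}(l b e_{l,j} + b e_{l,j-1}) + b^2 S'_{l,j} e_{l,j}\<close>
definition aX :: "(rat \<Rightarrow> nat \<Rightarrow> complex fps) \<Rightarrow> (rat \<Rightarrow> nat \<Rightarrow> complex fps)" where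
  "aX f = (\<lambda>l j. fps_const (of_rat l) * fps_X * f l j + fps_X * f l (Suc j)
                  + fps_X ^ 2 * fps_deriv (f l j))"

definition theme :: "('i::finite \<Rightarrow> 'i \<Rightarrow> complex fps) \<Rightarrow> bool" where
  "theme M \<longleftrightarrow> (\<exists>\<phi>\<in>Xi. \<exists>h. bij_betw h UNIV (atilde_span Xi smX aX \<phi>)
      \<and> (\<forall>x y. h (x + y) = h x + h y)
      \<and> (\<forall>S x. h (smE S x) = smX S (h x))
      \<and> (\<forall>x. h (aE M x) = aX (h x)))"

end

theory Submission
  imports Defs
begin

text \<open>
  Put \<open>N = b\<^sup>-\<^sup>1 a\<close> on the localisation \<open>V\<close> of \<open>E\<close> over the Laurent field, so that
  \<open>N (c y) = c N y + b c' y\<close>. A line of \<open>V\<close> spanned by an eigenvector of \<open>N\<close> meets \<open>E\<close> in a normal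
  submodule of rank one, so all eigenvectors of \<open>N\<close> lie on a single line, spanned by some \<open>w0\<close>; as
  \<open>E\<close> is geometric, a power of \<open>b\<close> brings the eigenvalue of \<open>w0\<close> to a rational \<open>l \<in> ]0,1]\<close>.
  Regularity makes the saturation a lattice of \<open>V\<close>, and an eigenvector of \<open>N\<close> modulo \<open>b\<close> (and modulo
  any \<open>N\<close>-stable subspace) lifts, after shifting its eigenvalue by an integer, to a genuine one. Hence
  every Bernstein root lies in \<open>- l + \<int>\<close>, and \<open>V\<close> is exhausted by a chain of \<open>N\<close>-stable subspaces with
  one-dimensional quotients. The space of finite sums of \<open>e\<^bsub>l,j\<^esub>\<close> with Laurent coefficients is
  injective enough to extend \<open>w0 \<mapsto> e\<^bsub>l,0\<^esub>\<close> along this chain, and each extension stays injective since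
  its kernel would contain an eigenvector off the line of \<open>w0\<close>. Finally a pole in the image of the
  saturation would produce a nonnegative Bernstein root, so \<open>E\<close> itself lands in \<open>\<Xi>\<^bsub>l\<^esub>\<close>.
\<close>

section \<open>Laurent series and Laurent vectors\<close>

unbundle Formal_Power_Series.fps_syntax
unbundle Formal_Laurent_Series.fps_syntax

text \<open>Integer powers of \<open>b\<close>, negative ones included; as shifts of 1 they act on
  coefficients by mere reindexing.\<close>

definition bpow :: "int \<Rightarrow> complex fls" where
  "bpow n = fls_shift (- n) 1"

lemma bpow_mult_nth [simp]: "(bpow n * f) $$ k = f $$ (k - n)"
  by (simp add: bpow_def fls_shifted_times_simps)

lemma bpow_nth: "bpow n $$ k = (if k = n then 1 else 0)"
  by (auto simp: bpow_def)

lemma bpow_0 [simp]: "bpow 0 = 1"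
  by (simp add: bpow_def)

lemma bpow_add: "bpow m * bpow n = bpow (m + n)"
  by (rule fls_eqI) (auto simp: bpow_nth)

lemma bpow_nonzero [simp]: "bpow n \<noteq> 0"
  by (simp add: bpow_def fls_shift_eq0_iff)

lemma fls_X_eq_bpow: "fls_X = bpow 1"
  by (rule fls_eqI) (simp add: bpow_nth)

lemma fls_X_inv_eq_bpow: "fls_X_inv = bpow (-1)"
  by (rule fls_eqI) (simp add: bpow_nth)

text \<open>The Euler derivation b d/db, diagonal on powers of \<open>b\<close>. It is the
  correction term that arises when b^-1 a is moved past a scalar.\<close>

definition theta :: "complex fls \<Rightarrow> complex fls" where
  "theta c = fls_X * fls_deriv c"

lemma theta_nth [simp]: "theta c $$ n = of_int n * c $$ n"
  by (simp add: theta_def fls_X_eq_bpow)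

lemma theta_add: "theta (c + d) = theta c + theta d"
  by (rule fls_eqI) (simp add: algebra_simps)

lemma theta_mult: "theta (c * d) = theta c * d + c * theta d"
  by (simp add: theta_def algebra_simps)

lemma theta_const [simp]: "theta (fls_const c) = 0"
  by (rule fls_eqI) simp

lemma theta_0 [simp]: "theta 0 = 0"
  by (rule fls_eqI) simp

lemma theta_1 [simp]: "theta 1 = 0"
  using theta_const[of 1] by simp

lemma theta_bpow: "theta (bpow n) = fls_const (of_int n) * bpow n"
  by (rule fls_eqI) (simp add: bpow_nth)

lemma fls_X_inv_X2: "fls_X_inv * (fls_X ^ 2 * c) = (fls_X * c :: complex fls)"
  by (simp add: fls_X_eq_bpow fls_X_inv_eq_bpow power2_eq_square bpow_add flip: mult.assoc)

text \<open>The index type is left arbitrary because the same scaling serves the localisation of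
  \<open>E\<close> (finite index) and logarithmic series (index \<open>nat\<close>).\<close>

definition fscale :: "complex fls \<Rightarrow> ('j \<Rightarrow> complex fls) \<Rightarrow> ('j \<Rightarrow> complex fls)" (infixr "*\<^sub>K" 75) where
  "c *\<^sub>K y = (\<lambda>i. c * y i)"

lemma fscale_apply [simp]: "(c *\<^sub>K y) i = c * y i"
  by (simp add: fscale_def)

interpretation fls_vs: vector_space fscale
  by unfold_locales (auto simp: fscale_def algebra_simps fun_eq_iff)

interpretation fls_vs_pair: vector_space_pair fscale fscale
  by unfold_locales

lemma smL_eq: "smL S y = fps_to_fls S *\<^sub>K y"
  by (simp add: smL_def fscale_def)

definition unit_vec :: "'i \<Rightarrow> 'i \<Rightarrow> complex fls" where
  "unit_vec i = (\<lambda>j. if j = i then 1 else 0)"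

lemma unit_vec_expand: "y = (\<Sum>i\<in>UNIV. y i *\<^sub>K unit_vec (i::'i::finite))"
proof
  fix j
  have "(\<Sum>i\<in>UNIV. y i *\<^sub>K unit_vec i) j = (\<Sum>i\<in>UNIV. (y i *\<^sub>K unit_vec i) j)"
    by (induction rule: infinite_finite_induct[of _ UNIV]) auto
  also have "\<dots> = (\<Sum>i\<in>UNIV. if i = j then y j else 0)"
    by (intro sum.cong) (auto simp: unit_vec_def)
  finally show "y j = (\<Sum>i\<in>UNIV. y i *\<^sub>K unit_vec i) j" by simp
qed

text \<open>The unit vectors span, so exchange applies. All finiteness arguments by dimension rest
  on this bound.\<close>

lemma independent_card_bound:
  assumes "fls_vs.independent (B :: ('i::finite \<Rightarrow> complex fls) set)"
  shows "finite B \<and> card B \<le> card (UNIV :: 'i set)"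
proof -
  have "y \<in> fls_vs.span (range unit_vec)" for y :: "'i \<Rightarrow> complex fls"
    by (subst unit_vec_expand)
      (intro fls_vs.span_sum fls_vs.span_scale fls_vs.span_base rangeI)
  then have "finite B \<and> card B \<le> card (range (unit_vec :: 'i \<Rightarrow> _))"
    by (intro fls_vs.independent_span_bound[OF _ assms]) auto
  with card_image_le[of "UNIV::'i set" unit_vec] show ?thesis by auto
qed

text \<open>The b-adic filtration of the coordinate lattice, of which \<open>val_ge 0\<close> is
  \<open>E\<close> itself. The bound is uniform in the coordinate, which matters when the index set
  is infinite.\<close>

definition val_ge :: "int \<Rightarrow> ('j \<Rightarrow> complex fls) set" where
  "val_ge d = {y. \<forall>j n. n < d \<longrightarrow> y j $$ n = 0}"

lemma val_ge_add: "x \<in> val_ge d \<Longrightarrow> y \<in> val_ge d \<Longrightarrow> x + y \<in> val_ge d"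
  by (auto simp: val_ge_def)

lemma val_ge_mono: "x \<in> val_ge d \<Longrightarrow> e \<le> d \<Longrightarrow> x \<in> val_ge e"
  by (auto simp: val_ge_def)

lemma val_ge_bpow [simp]: "bpow n *\<^sub>K x \<in> val_ge d \<longleftrightarrow> x \<in> val_ge (d - n)"
proof -
  have "(\<forall>k<d. x j $$ (k - n) = 0) \<longleftrightarrow> (\<forall>k<d - n. x j $$ k = 0)" for j
    by (metis add_diff_cancel_right' diff_add_cancel diff_strict_right_mono less_diff_eq)
  then show ?thesis by (simp add: val_ge_def)
qed

lemma val_ge_all_eq_0: "(\<And>d::nat. x \<in> val_ge (int d)) \<Longrightarrow> x = 0"
proof (rule ext, rule fls_eqI)
  fix j n assume "\<And>d::nat. x \<in> val_ge (int d)"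
  then have "x \<in> val_ge (int (nat (n + 1)))" .
  then show "x j $$ n = 0 j $$ n" by (auto simp: val_ge_def)
qed

lemma fls_mult_nth_below:
  assumes "\<And>n. n < d \<Longrightarrow> (f :: complex fls) $$ n = 0" "\<And>n. n < e \<Longrightarrow> g $$ n = 0" "n < d + e"
  shows "(f * g) $$ n = 0"
proof (cases "f = 0 \<or> g = 0")
  case False
  then have "d \<le> fls_subdegree f" "e \<le> fls_subdegree g"
    using assms by (auto intro!: fls_subdegree_geI)
  then show ?thesis using assms(3) by (intro fls_times_nth_eq0) auto
qed auto

lemma val_ge_fscale_mult:
  assumes "\<And>n. n < d \<Longrightarrow> c $$ n = 0" "y \<in> val_ge e"
  shows "c *\<^sub>K y \<in> val_ge (d + e)"
  using assms by (auto simp: val_ge_def intro: fls_mult_nth_below)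

lemma val_ge_fps [simp]: "y \<in> val_ge d \<Longrightarrow> fps_to_fls S *\<^sub>K y \<in> val_ge d"
  using val_ge_fscale_mult[of 0 "fps_to_fls S" y d] by simp

lemma val_ge_0_eq: "val_ge 0 = range liftL"
proof (intro set_eqI iffI)
  fix y :: "'a \<Rightarrow> complex fls" assume y: "y \<in> val_ge 0"
  have "y = liftL (\<lambda>i. fls_regpart (y i))"
    unfolding liftL_def by (intro ext fls_eqI) (use y in \<open>auto simp: val_ge_def\<close>)
  then show "y \<in> range liftL" by blast
qed (auto simp: val_ge_def liftL_def)

lemma val_ge_exists: "\<exists>m::nat. y \<in> val_ge (- int m)" for y :: "'i::finite \<Rightarrow> complex fls"
proof -
  define m where "m = Max (range (\<lambda>i. nat (- fls_subdegree (y i))))"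
  have "nat (- fls_subdegree (y i)) \<le> m" for i
    unfolding m_def by (intro Max_ge) auto
  then have "- int m \<le> fls_subdegree (y i)" for i
    by (metis minus_le_iff nat_le_iff)
  then show ?thesis 
    by (intro exI[of _ m]) (auto simp: val_ge_def intro!: fls_eq0_below_subdegree intro: less_le_trans)
qed

text \<open>Only finitely many basis images occur, so their worst pole bounds the loss of order
  everywhere. This is b-adic continuity of linear maps.\<close>

lemma linear_val_ge:
  assumes "Vector_Spaces.linear fscale fscale (h :: ('i::finite \<Rightarrow> complex fls) \<Rightarrow> ('j \<Rightarrow> complex fls))"
    and "\<And>i. h (unit_vec i) \<in> val_ge (- int (m i))"
  shows "\<exists>m::nat. \<forall>d. \<forall>y\<in>val_ge d. h y \<in> val_ge (d - int m)"
proof -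
  interpret h: Vector_Spaces.linear fscale fscale h by fact
  define M where "M = Max (range m)"
  have M: "m i \<le> M" for i unfolding M_def by (intro Max_ge) auto
  have "h y \<in> val_ge (d - int M)" if "y \<in> val_ge d" for d y
  proof -
    have sum: "(\<Sum>i\<in>A. g i) \<in> val_ge e" if "\<And>i. i \<in> A \<Longrightarrow> g i \<in> val_ge e" "finite A"
      for A and g :: "'i \<Rightarrow> 'j \<Rightarrow> complex fls" and e
      using that(2,1) by (induction) (auto intro!: val_ge_add, simp add: val_ge_def)
    have "h y = (\<Sum>i\<in>UNIV. y i *\<^sub>K h (unit_vec i))"
      by (subst unit_vec_expand) (simp add: h.sum h.scale)
    moreover have "y i *\<^sub>K h (unit_vec i) \<in> val_ge (d - int M)" for i
    proof (rule val_ge_mono)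
      show "y i *\<^sub>K h (unit_vec i) \<in> val_ge (d + - int (m i))"
        by (rule val_ge_fscale_mult) (use that assms in \<open>auto simp: val_ge_def\<close>)
      show "d - int M \<le> d + - int (m i)" using M[of i] by simp
    qed
    ultimately show ?thesis using sum[of UNIV] by simp
  qed
  then show ?thesis by blast
qed

lemmas pointwise_simps = plus_fun_apply zero_fun_apply fscale_apply minus_apply uminus_apply

declare pointwise_simps [simp del]

section \<open>Lattices stable under a regular operator\<close>

locale connection =
  fixes N :: "('i \<Rightarrow> complex fls) \<Rightarrow> 'i \<Rightarrow> complex fls"
  assumes N_add: "N (x + y) = N x + N y"
    and N_scale: "N (c *\<^sub>K y) = c *\<^sub>K N y + theta c *\<^sub>K y"
begin

text \<open>The sign agrees with the Bernstein polynomial, which is defined through - b^-1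
  a.\<close>

definition T :: "('i \<Rightarrow> complex fls) \<Rightarrow> 'i \<Rightarrow> complex fls" where
  "T y = - N y"

lemma T_add: "T (x + y) = T x + T y"
  by (simp add: T_def N_add)

lemma T_scale: "T (c *\<^sub>K y) = c *\<^sub>K T y - theta c *\<^sub>K y"
  by (simp add: T_def N_scale)

lemma T_const: "T (fls_const c *\<^sub>K y) = fls_const c *\<^sub>K T y"
  by (simp add: T_scale)

lemma T_0 [simp]: "T 0 = 0"
  using T_scale[of 0 0] by simp

lemma T_uminus: "T (- y) = - T y"
  using T_add[of y "- y"] by (simp add: add_eq_0_iff2)

lemma T_diff: "T (x - y) = T x - T y"
  using T_add[of x "- y"] by (simp add: T_uminus)

lemma T_sum: "T (\<Sum>k\<in>A. f k) = (\<Sum>k\<in>A. T (f k))"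
  by (induction A rule: infinite_finite_induct) (auto simp: T_add)

text \<open>Multiplying an eigenvector of \<open>T\<close> by b^n lowers its eigenvalue by
  \<open>n\<close>. This is the source of all integer shifts of eigenvalues.\<close>

lemma T_bpow: "T (bpow n *\<^sub>K y) = bpow n *\<^sub>K (T y - fls_const (of_int n) *\<^sub>K y)"
  by (simp add: T_scale theta_bpow fls_vs.scale_right_diff_distrib mult.commute)

abbreviation pact :: "complex poly \<Rightarrow> ('i \<Rightarrow> complex fls) \<Rightarrow> 'i \<Rightarrow> complex fls" where
  "pact \<equiv> poly_op smL T"

lemma pact_eq:
  assumes "degree p \<le> n"
  shows "pact p x = (\<Sum>k\<le>n. fls_const (coeff p k) *\<^sub>K (T ^^ k) x)"
  unfolding poly_op_def smL_eq fps_const_to_fls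
  by (rule sum.mono_neutral_left) (use assms in \<open>auto simp: coeff_eq_0\<close>)

lemma pact_0 [simp]: "pact 0 x = 0"
  by (simp add: poly_op_def smL_eq)

lemma pact_pCons: "pact (pCons a p) x = fls_const a *\<^sub>K x + T (pact p x)"
proof -
  have "pact (pCons a p) x = (\<Sum>k\<le>Suc (degree p). fls_const (coeff (pCons a p) k) *\<^sub>K (T ^^ k) x)"
    by (rule pact_eq) (rule degree_pCons_le)
  also have "\<dots> = fls_const a *\<^sub>K x + T (pact p x)"
    by (subst sum.atMost_Suc_shift) (simp add: pact_eq[OF order_refl] T_sum T_const)
  finally show ?thesis .
qed

lemma pact_add: "pact (p + q) x = pact p x + pact q x"
  by (induction p q rule: poly_induct2)
     (auto simp: pact_pCons T_add fls_vs.scale_left_distrib simp flip: fls_plus_const)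

lemma pact_smult: "pact (smult a p) x = fls_const a *\<^sub>K pact p x"
  by (induction p) (auto simp: pact_pCons T_const fls_vs.scale_right_distrib fls_const_mult_const)

text \<open>\<open>theta\<close> kills constants, so \<open>T\<close> is complex linear and
  evaluation of complex polynomials at \<open>T\<close> is multiplicative, although \<open>T\<close>
  is not linear over Laurent series.\<close>

lemma pact_mult: "pact (p * q) x = pact p (pact q x)"
  by (induction p) (auto simp: pact_pCons pact_add pact_smult)

lemma pact_linear: "pact p (fls_const c *\<^sub>K x + y) = fls_const c *\<^sub>K pact p x + pact p y"
  by (induction p)
     (auto simp: pact_pCons T_const T_add fls_vs.scale_right_distrib fls_vs.scale_left_commute ac_simps)

lemma pact_sum: "pact p (\<Sum>k\<in>A. fls_const (c k) *\<^sub>K f k) = (\<Sum>k\<in>A. fls_const (c k) *\<^sub>K pact p (f k))"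
proof (induction A rule: infinite_finite_induct)
  case (insert a A)
  then show ?case by (simp add: pact_linear)
next
  case empty
  show ?case using pact_linear[of p 1 0 0] by simp
next
  case (infinite A)
  then show ?case using pact_linear[of p 1 0 0] by simp
qed

lemma pact_monom: "pact (monom c k) x = fls_const c *\<^sub>K (T ^^ k) x"
  by (induction k) (auto simp: pact_pCons monom_Suc T_const monom_0)

lemma pact_const: "pact [:c:] x = fls_const c *\<^sub>K x"
  by (simp add: pact_pCons)

lemma pact_linear_factor: "pact [:- z, 1:] x = T x - fls_const z *\<^sub>K x"
  by (simp add: pact_pCons)

end

text \<open>An abstract form of the saturation. The two inclusions make \<open>Lam\<close>
  commensurable with the coordinate lattice; the bound on poles does the work of finite
  generation.\<close>

locale connection_lattice = connection N
  for N :: "('i::finite \<Rightarrow> complex fls) \<Rightarrow> 'i \<Rightarrow> complex fls" +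
  fixes Lam :: "('i \<Rightarrow> complex fls) set" and m :: nat
  assumes Lam_add: "x \<in> Lam \<Longrightarrow> y \<in> Lam \<Longrightarrow> x + y \<in> Lam"
    and Lam_smL: "x \<in> Lam \<Longrightarrow> smL S x \<in> Lam"
    and Lam_N: "x \<in> Lam \<Longrightarrow> N x \<in> Lam"
    and Lam_lower: "val_ge 0 \<subseteq> Lam"
    and Lam_upper: "Lam \<subseteq> val_ge (- int m)"
begin

text \<open>This is b^n \<open>Lam\<close>, put as a membership condition so that closure properties
  reduce to those of \<open>Lam\<close>.\<close>

definition bfilt :: "nat \<Rightarrow> ('i \<Rightarrow> complex fls) set" where
  "bfilt n = {y. bpow (- int n) *\<^sub>K y \<in> Lam}"

lemma Lam_scale:
  assumes "y \<in> Lam" "\<And>n. n < 0 \<Longrightarrow> c $$ n = 0"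
  shows "c *\<^sub>K y \<in> Lam"
proof -
  have "c = fps_to_fls (fls_regpart c)"
    by (rule fls_eqI) (use assms in auto)
  then show ?thesis using Lam_smL[OF assms(1), of "fls_regpart c"] by (simp add: smL_eq)
qed

lemma bfilt_0 [simp]: "bfilt 0 = Lam"
  by (simp add: bfilt_def)

lemma bfilt_scale:
  assumes "y \<in> Lam" "\<And>k. k < int n \<Longrightarrow> c $$ k = 0"
  shows "c *\<^sub>K y \<in> bfilt n"
  unfolding bfilt_def using Lam_scale[OF assms(1), of "bpow (- int n) * c"] assms(2) by simp

lemma bfilt_bpow: "y \<in> Lam \<Longrightarrow> int n \<le> k \<Longrightarrow> bpow k *\<^sub>K y \<in> bfilt n"
  by (rule bfilt_scale) (auto simp: bpow_nth)

lemma bfilt_obtain: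
  assumes "y \<in> bfilt n"
  obtains x where "x \<in> Lam" "y = bpow (int n) *\<^sub>K x"
proof
  show "bpow (- int n) *\<^sub>K y \<in> Lam" using assms by (simp add: bfilt_def)
qed (simp add: bpow_add)

lemma Lam_const: "y \<in> Lam \<Longrightarrow> fls_const c *\<^sub>K y \<in> Lam"
  by (rule Lam_scale) auto

lemma Lam_T: "y \<in> Lam \<Longrightarrow> T y \<in> Lam"
  unfolding T_def using Lam_const[of "N y" "-1"] Lam_N[of y]
  by (simp)

lemma Lam_0: "0 \<in> Lam"
  using Lam_lower by (auto simp: val_ge_def zero_fun_apply)

lemma Lam_T_shift: "y \<in> Lam \<Longrightarrow> T y - fls_const c *\<^sub>K y \<in> Lam"
  using Lam_add[OF Lam_T Lam_const[of y "- c"]] by (simp)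

lemma Lam_pact: "y \<in> Lam \<Longrightarrow> pact p y \<in> Lam"
  by (induction p) (auto simp: pact_pCons Lam_0 intro!: Lam_add Lam_T Lam_const)

lemma bfilt_add: "x \<in> bfilt n \<Longrightarrow> y \<in> bfilt n \<Longrightarrow> x + y \<in> bfilt n"
  by (simp add: bfilt_def fls_vs.scale_right_distrib Lam_add)

lemma bfilt_0_mem: "0 \<in> bfilt n"
  by (simp add: bfilt_def Lam_0)

lemma bfilt_const: "y \<in> bfilt n \<Longrightarrow> fls_const c *\<^sub>K y \<in> bfilt n"
  by (simp add: bfilt_def fls_vs.scale_left_commute[of "bpow _"] Lam_const del: fls_vs.scale_scale)

lemma bfilt_diff: "x \<in> bfilt n \<Longrightarrow> y \<in> bfilt n \<Longrightarrow> x - y \<in> bfilt n"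
  using bfilt_add[OF _ bfilt_const[of y n "-1"]] by (simp)

lemma bfilt_sum: "(\<And>k. k \<in> A \<Longrightarrow> f k \<in> bfilt n) \<Longrightarrow> (\<Sum>k\<in>A. f k) \<in> bfilt n"
  by (induction A rule: infinite_finite_induct) (auto intro: bfilt_add bfilt_0_mem)

lemma bfilt_T: "y \<in> bfilt n \<Longrightarrow> T y \<in> bfilt n"
  by (elim bfilt_obtain) (auto simp: T_bpow intro!: bfilt_bpow Lam_T_shift)

lemma bfilt_antimono: "y \<in> bfilt n \<Longrightarrow> k \<le> n \<Longrightarrow> y \<in> bfilt k"
  by (elim bfilt_obtain) (auto intro!: bfilt_bpow)

lemma bfilt_upper: "y \<in> bfilt n \<Longrightarrow> y \<in> val_ge (int n - int m)"
  using Lam_upper by (elim bfilt_obtain) auto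

lemma bfilt_lower: "y \<in> val_ge (int n) \<Longrightarrow> y \<in> bfilt n"
  using Lam_lower by (auto simp: bfilt_def)

lemma bfilt_1_eq: "smL fps_X ` Lam = bfilt 1"
  by (auto simp: smL_eq fls_X_eq_bpow elim!: bfilt_obtain intro!: bfilt_bpow)

text \<open>Every coefficient of the sequence stabilises, which defines the limit. The filtrations
  \<open>bfilt\<close> and \<open>val_ge\<close> differ by at most \<open>m\<close> steps, so both
  have the same Cauchy sequences.\<close>

lemma Lam_complete:
  assumes Y: "\<And>k. Y k \<in> Lam" and step: "\<And>k. Y (Suc k) - Y k \<in> bfilt (Suc k)"
  shows "\<exists>L\<in>Lam. \<forall>k. L - Y k \<in> bfilt (Suc k)"
proof -
  have tail: "Y (k + j) - Y k \<in> bfilt (Suc k)" for k j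
  proof (induction j)
    case (Suc j)
    have "Y (k + Suc j) - Y (k + j) \<in> bfilt (Suc k)"
      using step[of "k + j"] by (auto intro: bfilt_antimono)
    from bfilt_add[OF this Suc] show ?case by simp
  qed (auto simp: bfilt_0_mem)
  \<comment> \<open>From stage n + m on, all changes lie in \<open>bfilt (n + m + 1)\<close>, hence
    in \<open>val_ge (n + 1)\<close>, and no longer touch coefficient \<open>n\<close>. Below - m
    all coefficients vanish, so truncation by \<open>nat\<close> is harmless.\<close>
  define L where "L i = Abs_fls (\<lambda>n. Y (nat (n + int m)) i $$ n)" for i
  have "Y k i $$ n = 0" if "n < - int m" for k i n
    using Y[of k] Lam_upper that by (auto simp: val_ge_def)
  then have L: "L i $$ n = Y (nat (n + int m)) i $$ n" for i n
    unfolding L_def by (subst nth_Abs_fls_lower_bound[of "- int m"]) auto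
  have lim: "L - Y k \<in> val_ge (int k - int m)" for k
    unfolding val_ge_def
  proof (safe)
    fix i n assume n: "n < int k - int m"
    define l where "l = nat (n + int m)"
    have "l \<le> k" "n < int (Suc l) - int m" using n by (auto simp: l_def)
    then have "Y k - Y l \<in> bfilt (Suc l)" using tail[of l "k - l"] by simp
    then have "Y k - Y l \<in> val_ge (int (Suc l) - int m)" by (rule bfilt_upper)
    with \<open>n < int (Suc l) - int m\<close> have "(Y k - Y l) i $$ n = 0"
      unfolding val_ge_def by blast
    then show "(L - Y k) i $$ n = 0" using L[of i n] by (simp add: l_def minus_apply)
  qed
  \<comment> \<open>Passing from \<open>val_ge\<close> back to \<open>bfilt\<close> costs
    \<open>m\<close> steps; comparing at stage k + m + 1 makes up for them.\<close>
  have main: "L - Y k \<in> bfilt (Suc k)" for k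
  proof -
    have "L - Y (k + Suc m) \<in> bfilt (Suc k)"
      using lim[of "k + Suc m"] by (intro bfilt_lower) simp
    from bfilt_add[OF this tail[of k "Suc m"]] show ?thesis by simp
  qed
  have "L - Y 0 \<in> Lam" using bfilt_antimono[OF main[of 0], of 0] by simp
  from Lam_add[OF this Y[of 0]] have "L \<in> Lam" by simp
  with main show ?thesis by blast
qed

section \<open>Annihilating polynomials of \<open>T\<close> on the lattice modulo
  \<open>b\<close>\<close>

definition annih :: "complex poly \<Rightarrow> bool" where
  "annih p \<longleftrightarrow> (\<forall>y\<in>Lam. pact p y \<in> bfilt 1)"

definition indep_mod :: "('i \<Rightarrow> complex fls) set \<Rightarrow> bool" where
  "indep_mod D \<longleftrightarrow> finite D \<and> D \<subseteq> Lam
    \<and> (\<forall>c. (\<Sum>d\<in>D. fls_const (c d) *\<^sub>K d) \<in> bfilt 1 \<longrightarrow> (\<forall>d\<in>D. c d = 0))"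

text \<open>Clear denominators in a relation over the Laurent field, divide by the common power of
  \<open>b\<close>, and look at the constant terms.\<close>
lemma indep_mod_imp_independent:
  assumes "indep_mod D"
  shows "fls_vs.independent D"
proof
  assume "fls_vs.dependent D"
  moreover have fin: "finite D" using assms by (simp add: indep_mod_def)
  ultimately obtain u v0 where u: "(\<Sum>v\<in>D. u v *\<^sub>K v) = 0" and v0: "v0 \<in> D" "u v0 \<noteq> 0"
    by (auto simp: fls_vs.dependent_finite)
  define S where "S = {v \<in> D. u v \<noteq> 0}"
  have "finite S" "S \<noteq> {}" using fin v0 by (auto simp: S_def)
  then obtain v1 where v1: "v1 \<in> S" "\<And>v. v \<in> S \<Longrightarrow> fls_subdegree (u v1) \<le> fls_subdegree (u v)"
    using arg_min_if_finite(1)[of S "\<lambda>v. fls_subdegree (u v)"] arg_min_least[of S _ "\<lambda>v. fls_subdegree (u v)"]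
    by blast
  define w where "w v = bpow (- fls_subdegree (u v1)) * u v" for v
  have neg: "w v $$ n = 0" if "n < 0" "v \<in> D" for v n
  proof (cases "u v = 0")
    case False
    with v1(2)[of v] that show ?thesis by (simp add: w_def S_def)
  qed (simp add: w_def)
  have "(\<Sum>v\<in>D. w v *\<^sub>K v) = bpow (- fls_subdegree (u v1)) *\<^sub>K (\<Sum>v\<in>D. u v *\<^sub>K v)"
    by (simp add: fls_vs.scale_sum_right w_def)
  then have w0: "(\<Sum>v\<in>D. w v *\<^sub>K v) = 0" by (simp add: u)
  have "(w v - fls_const (w v $$ 0)) *\<^sub>K v \<in> bfilt 1" if "v \<in> D" for v
  proof (rule bfilt_scale)
    show "v \<in> Lam" using that assms by (auto simp: indep_mod_def)
    show "(w v - fls_const (w v $$ 0)) $$ k = 0" if "k < int 1" for k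
      using that neg[of k v] \<open>v \<in> D\<close> by (cases "k = 0") auto
  qed
  then have "(\<Sum>v\<in>D. (w v - fls_const (w v $$ 0)) *\<^sub>K v) \<in> bfilt 1" by (rule bfilt_sum)
  moreover have "(\<Sum>v\<in>D. (w v - fls_const (w v $$ 0)) *\<^sub>K v)
      = (\<Sum>v\<in>D. w v *\<^sub>K v) - (\<Sum>v\<in>D. fls_const (w v $$ 0) *\<^sub>K v)"
    by (simp add: fls_vs.scale_left_diff_distrib sum_subtractf)
  ultimately have "(\<Sum>v\<in>D. fls_const (w v $$ 0) *\<^sub>K v) \<in> bfilt 1"
    using bfilt_diff[OF bfilt_0_mem] w0 by fastforce
  then have "w v1 $$ 0 = 0"
    using assms v1(1) by (auto simp: indep_mod_def S_def)
  moreover have "w v1 $$ 0 \<noteq> 0" using v1(1) by (simp add: w_def S_def)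
  ultimately show False by simp
qed

lemma indep_mod_card: "indep_mod D \<Longrightarrow> card D \<le> card (UNIV :: 'i set)"
  using indep_mod_imp_independent independent_card_bound by blast

text \<open>\<open>Lam\<close> modulo b \<open>Lam\<close> has complex dimension at most
  \<open>card UNIV\<close>, so one iterate of \<open>T\<close> more than that yields a linear
  relation, whose coefficients form \<open>p\<close>. Coinciding iterates do not give enough
  distinct vectors and are treated apart, by a difference of two monomials.\<close>

lemma annih_vector:
  assumes y: "y \<in> Lam"
  shows "\<exists>p. p \<noteq> 0 \<and> pact p y \<in> bfilt 1"
proof -
  define k where "k = card (UNIV :: 'i set)"
  define f where "f i = (T ^^ i) y" for i
  have fL: "f i \<in> Lam" for i unfolding f_def by (induction i) (auto simp: y Lam_T)
  show ?thesis
  proof (cases "inj_on f {..k}")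
    case False
    then obtain i j where ij: "i \<noteq> j" "f i = f j" by (auto simp: inj_on_def)
    have "pact (monom 1 i + monom (-1) j) y = 0"
      using ij by (simp add: pact_add pact_monom f_def)
    moreover have "coeff (monom 1 i + monom (-1) j :: complex poly) i \<noteq> 0" using ij by simp
    ultimately show ?thesis using bfilt_0_mem by (metis coeff_0)
  next
    case True
    define D where "D = f ` {..k}"
    have "card D = Suc k" using True by (simp add: D_def card_image)
    then have "\<not> indep_mod D" using indep_mod_card[of D] by (auto simp: k_def)
    then obtain c d where c: "(\<Sum>d\<in>D. fls_const (c d) *\<^sub>K d) \<in> bfilt 1" "d \<in> D" "c d \<noteq> 0"
      using fL by (auto simp: indep_mod_def D_def)
    define p where "p = (\<Sum>i\<le>k. monom (c (f i)) i)"
    have coeff: "coeff p i = (if i \<le> k then c (f i) else 0)" for i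
      by (simp add: p_def coeff_sum)
    have "degree p \<le> k" by (rule degree_le) (simp add: coeff)
    then have "pact p y = (\<Sum>i\<le>k. fls_const (c (f i)) *\<^sub>K f i)"
      by (simp add: pact_eq coeff f_def)
    also have "\<dots> = (\<Sum>d\<in>D. fls_const (c d) *\<^sub>K d)"
      unfolding D_def by (subst sum.reindex[OF True]) simp
    finally have "pact p y \<in> bfilt 1" using c by simp
    moreover obtain i where "i \<le> k" "d = f i" using c by (auto simp: D_def)
    with c coeff[of i] have "p \<noteq> 0" by auto
    ultimately show ?thesis by blast
  qed
qed

text \<open>A largest set independent modulo \<open>b\<close> spans \<open>Lam\<close> modulo b
  \<open>Lam\<close>; the product of polynomials killing its members kills everything, since
  polynomials in \<open>T\<close> commute.\<close>

lemma annih_exists: "\<exists>p. p \<noteq> 0 \<and> annih p"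
proof -
  have "indep_mod {}" by (simp add: indep_mod_def)
  from ex_has_greatest_nat[of indep_mod, OF this, of card] indep_mod_card
  obtain D where D: "indep_mod D" and max: "\<And>D'. indep_mod D' \<Longrightarrow> card D' \<le> card D"
    by (metis less_Suc_eq_le)
  have fin: "finite D" and DL: "D \<subseteq> Lam" using D by (auto simp: indep_mod_def)
  from DL have "\<forall>d\<in>D. \<exists>p. p \<noteq> 0 \<and> pact p d \<in> bfilt 1" using annih_vector by blast
  then obtain P where P: "\<And>d. d \<in> D \<Longrightarrow> P d \<noteq> 0" "\<And>d. d \<in> D \<Longrightarrow> pact (P d) d \<in> bfilt 1"
    by metis
  define p where "p = (\<Prod>d\<in>D. P d)"
  have "p \<noteq> 0" using P fin by (simp add: p_def)
  have bfilt_pact: "pact q y \<in> bfilt 1" if "y \<in> bfilt 1" for q y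
    by (induction q) (use that in \<open>auto simp: pact_pCons bfilt_0_mem intro!: bfilt_add bfilt_T bfilt_const\<close>)
  have pd: "pact p d \<in> bfilt 1" if "d \<in> D" for d
  proof -
    have "p = (\<Prod>e\<in>D - {d}. P e) * P d"
      unfolding p_def using that fin by (subst prod.remove[of D d]) (auto simp: mult.commute)
    then show ?thesis using bfilt_pact P(2)[OF that] by (simp add: pact_mult)
  qed
  have "pact p y \<in> bfilt 1" if y: "y \<in> Lam" for y
  proof (cases "y \<in> D")
    case False
    then have "card (insert y D) > card D" using fin by simp
    with max have "\<not> indep_mod (insert y D)" by (meson not_le)
    then obtain c where c: "(\<Sum>d\<in>insert y D. fls_const (c d) *\<^sub>K d) \<in> bfilt 1"
      and nz: "\<exists>d\<in>insert y D. c d \<noteq> 0"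
      using fin DL y by (auto simp: indep_mod_def)
    have sum: "(\<Sum>d\<in>insert y D. fls_const (c d) *\<^sub>K d)
        = fls_const (c y) *\<^sub>K y + (\<Sum>d\<in>D. fls_const (c d) *\<^sub>K d)"
      using False fin by simp
    have cy: "c y \<noteq> 0"
    proof
      assume "c y = 0"
      with c sum D have "\<forall>d\<in>D. c d = 0" by (simp add: indep_mod_def)
      with nz \<open>c y = 0\<close> show False by auto
    qed
    have "pact p (\<Sum>d\<in>insert y D. fls_const (c d) *\<^sub>K d) \<in> bfilt 1" using bfilt_pact c by blast
    then have "fls_const (c y) *\<^sub>K pact p y + (\<Sum>d\<in>D. fls_const (c d) *\<^sub>K pact p d) \<in> bfilt 1"
      by (simp add: sum pact_linear pact_sum)
    moreover have "(\<Sum>d\<in>D. fls_const (c d) *\<^sub>K pact p d) \<in> bfilt 1"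
      using pd by (intro bfilt_sum bfilt_const)
    ultimately have "fls_const (c y) *\<^sub>K pact p y \<in> bfilt 1"
      using bfilt_diff by fastforce
    from bfilt_const[OF this, of "inverse (c y)"] show ?thesis
      using cy by (simp add: fls_const_mult_const)
  qed (rule pd)
  with \<open>p \<noteq> 0\<close> show ?thesis by (auto simp: annih_def)
qed

text \<open>The annihilating polynomials form a nonzero ideal, and division with remainder makes an
  element of least degree a generator. Uniqueness justifies the definite description in
  \<open>bernstein\<close>.\<close>

lemma minimal_annih: "\<exists>!p. lead_coeff p = 1 \<and> annih p \<and> (\<forall>q. annih q \<longrightarrow> p dvd q)"
proof -
  obtain p where p: "p \<noteq> 0" "annih p"
    and min: "\<And>q. q \<noteq> 0 \<Longrightarrow> annih q \<Longrightarrow> degree p \<le> degree q"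
    using annih_exists ex_has_least_nat[of "\<lambda>p. p \<noteq> 0 \<and> annih p" _ degree] by metis
  define p' where "p' = smult (inverse (lead_coeff p)) p"
  have p': "lead_coeff p' = 1" "annih p'" "degree p' = degree p"
    using p by (auto simp: p'_def annih_def pact_smult intro!: bfilt_const)
  have dvd: "p' dvd q" if q: "annih q" for q
  proof (rule ccontr)
    assume "\<not> p' dvd q"
    then have nz: "q mod p' \<noteq> 0" by (simp add: dvd_eq_mod_eq_0)
    have "p' \<noteq> 0" using p'(1) by auto
    with nz have "degree (q mod p') < degree p'" using degree_mod_less[of p' q] by auto
    have eq: "q = (q div p') * p' + q mod p'" by simp
    have "pact (q mod p') y \<in> bfilt 1" if y: "y \<in> Lam" for y
    proof -
      have "pact q y = pact (p' * (q div p')) y + pact (q mod p') y"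
        using arg_cong[OF eq, of "\<lambda>r. pact r y"] by (simp only: pact_add mult.commute)
      moreover have "pact (p' * (q div p')) y \<in> bfilt 1" "pact q y \<in> bfilt 1"
        using p'(2) q y by (auto simp: pact_mult annih_def intro!: Lam_pact)
      ultimately show ?thesis using bfilt_diff by fastforce
    qed
    with min[OF nz] \<open>degree (q mod p') < degree p'\<close> p'(3) show False by (auto simp: annih_def)
  qed
  show ?thesis
  proof (rule ex1I[of _ p'])
    fix r assume r: "lead_coeff r = 1 \<and> annih r \<and> (\<forall>q. annih q \<longrightarrow> r dvd q)"
    with p' dvd have "p' dvd r" "r dvd p'" by auto
    then obtain k where k: "r = p' * k" by (elim dvdE)
    have nz: "p' \<noteq> 0" "r \<noteq> 0" using p'(1) r by auto
    with \<open>r dvd p'\<close> have "degree r \<le> degree p'" by (intro dvd_imp_degree_le)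
    with nz k have "degree k = 0" by (auto simp: degree_mult_eq)
    then obtain c where "k = [:c:]" by (rule degree_eq_zeroE)
    with k r p'(1) show "r = p'" by (auto split: if_splits)
  qed (use p' dvd in auto)
qed

end

section \<open>Eigenvalues modulo \<open>b\<close> relative to a stable subspace\<close>

locale connection_lattice_sub = connection_lattice N Lam m
  for N :: "('i::finite \<Rightarrow> complex fls) \<Rightarrow> 'i \<Rightarrow> complex fls" and Lam m +
  fixes U :: "('i \<Rightarrow> complex fls) set"
  assumes U_sub: "fls_vs.subspace U"
    and U_N: "x \<in> U \<Longrightarrow> N x \<in> U"
begin

lemmas U_add = fls_vs.subspace_add[OF U_sub]
lemmas U_diff = fls_vs.subspace_diff[OF U_sub]
lemmas U_scale = fls_vs.subspace_scale[OF U_sub]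
lemmas U_0 = fls_vs.subspace_0[OF U_sub]

lemma U_T: "x \<in> U \<Longrightarrow> T x \<in> U"
  using fls_vs.subspace_neg[OF U_sub U_N] by (simp add: T_def)

text \<open>Membership in b^n \<open>Lam\<close> + \<open>U\<close>: the filtration that
  \<open>Lam\<close> induces on the quotient by \<open>U\<close>, expressed upstairs so that no
  quotient space has to be formed.\<close>

definition cong :: "nat \<Rightarrow> ('i \<Rightarrow> complex fls) \<Rightarrow> bool" where
  "cong n y \<longleftrightarrow> (\<exists>x\<in>bfilt n. y - x \<in> U)"

lemma cong_add: "cong n x \<Longrightarrow> cong n y \<Longrightarrow> cong n (x + y)"
  unfolding cong_def by (metis bfilt_add U_add add_diff_add)

lemma cong_const: "cong n x \<Longrightarrow> cong n (fls_const c *\<^sub>K x)"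
  unfolding cong_def by (metis bfilt_const U_scale fls_vs.scale_right_diff_distrib)

lemma cong_diff: "cong n x \<Longrightarrow> cong n y \<Longrightarrow> cong n (x - y)"
  using cong_add[OF _ cong_const[of n y "-1"]] by (simp)

lemma cong_pw: "x \<in> bfilt n \<Longrightarrow> cong n x"
  unfolding cong_def using U_0 by force

lemma cong_U: "x \<in> U \<Longrightarrow> cong n x"
  unfolding cong_def using bfilt_0_mem by force

lemma cong_T: "cong n x \<Longrightarrow> cong n (T x)"
  unfolding cong_def by (metis bfilt_T U_T T_diff)

lemma cong_pact: "cong n x \<Longrightarrow> cong n (pact p x)"
  by (induction p) (auto simp: pact_pCons cong_U U_0 intro!: cong_add cong_T cong_const)

lemma cong_antimono: "cong n x \<Longrightarrow> k \<le> n \<Longrightarrow> cong k x"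
  unfolding cong_def by (meson bfilt_antimono)

text \<open>A vector outside \<open>U\<close> is separated from \<open>U\<close> by a linear map, and linear maps are
  \<open>b\<close>-adically continuous.\<close>
lemma closed_U:
  assumes "\<And>n. cong n y"
  shows "y \<in> U"
proof (rule ccontr)
  assume y: "y \<notin> U"
  obtain B where B: "B \<subseteq> U" "fls_vs.independent B" "U \<subseteq> fls_vs.span B"
    using fls_vs.maximal_independent_subset by blast
  have spanB: "fls_vs.span B = U" using B U_sub
    by (simp add: fls_vs.span_minimal subset_antisym)
  have "fls_vs.independent (insert y B)"
    using y B spanB by (intro fls_vs.independent_insertI) auto
  from fls_vs_pair.linear_independent_extend[OF this, of "\<lambda>x. if x = y then y else 0"]
  obtain g :: "('i \<Rightarrow> complex fls) \<Rightarrow> 'i \<Rightarrow> complex fls"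
    where g: "\<forall>x\<in>insert y B. g x = (if x = y then y else 0)"
      and lin: "Vector_Spaces.linear fscale fscale g" by blast
  interpret g: Vector_Spaces.linear fscale fscale g by fact
  have "y \<notin> B" using y B by auto
  then have "\<And>b. b \<in> B \<Longrightarrow> g b = 0" using g by auto
  then have gU: "g u = 0" if "u \<in> U" for u
    using g.eq_0_on_span[of B u] that spanB by auto
  have gy: "g y = y" using g by auto
  have "\<forall>i. \<exists>k. g (unit_vec i) \<in> val_ge (- int k)" using val_ge_exists by blast
  then obtain k where "\<And>i. g (unit_vec i) \<in> val_ge (- int (k i))" by metis
  from linear_val_ge[OF lin this] obtain M
    where M: "\<And>d y. y \<in> val_ge d \<Longrightarrow> g y \<in> val_ge (d - int M)" by blast
  have "y \<in> val_ge (int d)" for d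
  proof -
    from assms[of "d + m + M"] obtain x where x: "x \<in> bfilt (d + m + M)" "y - x \<in> U"
      by (auto simp: cong_def)
    have "g y = g x" using gU[OF x(2)] by (simp add: g.diff)
    moreover have "x \<in> val_ge (int d + int M)" using bfilt_upper[OF x(1)] by simp
    from M[OF this] have "g x \<in> val_ge (int d)" by simp
    ultimately show ?thesis using gy by simp
  qed
  then have "y = 0" by (rule val_ge_all_eq_0)
  with y U_0 show False by simp
qed

text \<open>A Nakayama argument: if \<open>Lam\<close> lay in b \<open>Lam\<close> +
  \<open>U\<close>, iteration would put it in b^n \<open>Lam\<close> + \<open>U\<close> for all
  \<open>n\<close>, hence in \<open>U\<close> by closedness; but \<open>Lam\<close> spans the whole
  space over the Laurent field.\<close>

lemma not_cong_exists:
  assumes "U \<noteq> UNIV"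
  shows "\<exists>y\<in>Lam. \<not> cong 1 y"
proof (rule ccontr)
  assume "\<not> ?thesis"
  then have c1: "cong 1 y" if "y \<in> Lam" for y using that by blast
  have "cong n y" if "y \<in> Lam" for n y
  proof (induction n)
    case 0
    then show ?case using that by (intro cong_pw) simp
  next
    case (Suc n)
    then obtain x where x: "x \<in> bfilt n" "y - x \<in> U" by (auto simp: cong_def)
    then obtain x' where x': "x' \<in> Lam" "x = bpow (int n) *\<^sub>K x'" by (elim bfilt_obtain)
    from c1[OF x'(1)] obtain w where w: "w \<in> bfilt 1" "x' - w \<in> U" by (auto simp: cong_def)
    from w(1) obtain w' where w': "w' \<in> Lam" "w = bpow (int 1) *\<^sub>K w'" by (elim bfilt_obtain)
    have "y - bpow (int n) *\<^sub>K w = (y - x) + bpow (int n) *\<^sub>K (x' - w)"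
      by (simp add: x' fls_vs.scale_right_diff_distrib)
    also have "\<dots> \<in> U" using x w by (intro U_add U_scale)
    finally have "y - bpow (int n) *\<^sub>K w \<in> U" .
    moreover have "bpow (int n) *\<^sub>K w \<in> bfilt (Suc n)"
      using w' by (auto simp: bpow_add intro!: bfilt_bpow)
    ultimately show ?case by (auto simp: cong_def)
  qed
  then have LU: "Lam \<subseteq> U" using closed_U by blast
  have "y \<in> U" for y
  proof -
    obtain k where "y \<in> val_ge (- int k)" using val_ge_exists by blast
    then have "bpow (int k) *\<^sub>K y \<in> val_ge 0" by simp
    then have "bpow (int k) *\<^sub>K y \<in> U" using Lam_lower LU by (meson subsetD)
    from U_scale[OF this, of "bpow (- int k)"] show ?thesis by (simp add: bpow_add)
  qed
  with assms show False by auto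
qed

text \<open>Eigenvalues of \<open>T\<close> on the image of \<open>Lam\<close> in the quotient by
  \<open>U\<close>, reduced modulo \<open>b\<close>.\<close>

definition eig :: "complex \<Rightarrow> bool" where
  "eig z \<longleftrightarrow> (\<exists>y\<in>Lam. \<not> cong 1 y \<and> cong 1 (T y - fls_const z *\<^sub>K y))"

text \<open>Linear factors are split off \<open>p\<close> one at a time; the first time the
  remaining cofactor no longer kills \<open>y\<close>, its value at \<open>y\<close> is an
  eigenvector.\<close>

lemma eig_exists_aux:
  assumes "y \<in> Lam" "\<not> cong 1 y" "p \<noteq> 0" "cong 1 (pact p y)"
  shows "\<exists>z. eig z"
  using assms(3,4)
proof (induction "degree p" arbitrary: p rule: less_induct)
  case less
  show ?case
  proof (cases "degree p = 0")
    case True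
    then obtain c where c: "p = [:c:]" by (rule degree_eq_zeroE)
    with less.prems have "c \<noteq> 0" "cong 1 (fls_const c *\<^sub>K y)" by (auto simp: pact_pCons)
    then have "cong 1 y" using cong_const[of 1 "fls_const c *\<^sub>K y" "inverse c"]
      by (simp add: fls_const_mult_const)
    with assms show ?thesis by simp
  next
    case False
    then obtain z where "poly p z = 0"
      using alg_closed_imp_poly_has_root[of p] by blast
    then obtain q where q: "p = [:-z, 1:] * q" by (metis dvdE poly_eq_0_iff_dvd)
    with less.prems have "q \<noteq> 0" by auto
    then have deg: "degree q < degree p" unfolding q by (subst degree_mult_eq) auto
    show ?thesis
    proof (cases "cong 1 (pact q y)")
      case True
      with less.hyps deg \<open>q \<noteq> 0\<close> show ?thesis by blast
    next
      case False
      with less.prems(2) assms(1) show ?thesis unfolding q pact_mult pact_linear_factor eig_def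
        by (blast intro: Lam_pact)
    qed
  qed
qed

lemma annih_cong: "annih p \<Longrightarrow> y \<in> Lam \<Longrightarrow> cong 1 (pact p y)"
  by (auto simp: annih_def intro: cong_pw)

lemma eig_exists: "U \<noteq> UNIV \<Longrightarrow> \<exists>z. eig z"
  using not_cong_exists annih_exists eig_exists_aux annih_cong by metis

lemma eig_root:
  assumes "eig z" "annih p"
  shows "poly p z = 0"
proof (rule ccontr)
  assume pz: "poly p z \<noteq> 0"
  from assms obtain y where y: "y \<in> Lam" "\<not> cong 1 y" "cong 1 (T y - fls_const z *\<^sub>K y)"
    by (auto simp: eig_def)
  have "p = synthetic_div p z * [:-z, 1:] + [:poly p z:]"
    using synthetic_div_correct'[of z p] by (simp add: mult.commute)
  then have "pact p y = pact (synthetic_div p z * [:-z, 1:] + [:poly p z:]) y" by (rule arg_cong)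
  then have "pact p y = pact (synthetic_div p z) (T y - fls_const z *\<^sub>K y) + fls_const (poly p z) *\<^sub>K y"
    by (simp only: pact_add pact_mult pact_linear_factor pact_const)
  then have "fls_const (poly p z) *\<^sub>K y = pact p y - pact (synthetic_div p z) (T y - fls_const z *\<^sub>K y)"
    by simp
  then have "cong 1 (fls_const (poly p z) *\<^sub>K y)"
    using cong_diff annih_cong[OF assms(2) y(1)] cong_pact[OF y(3)] by simp
  from cong_const[OF this, of "inverse (poly p z)"] y pz show False
    by (simp add: fls_const_mult_const)
qed

text \<open>Injective implies surjective in finite dimension, done with polynomials. Write an
  annihilator as (X - z)^e q with q(z) nonzero. Injectivity of T - z leaves q(T) u = 0, and q = (X -
  z) r + q(z) then exhibits \<open>u\<close> as a value of T - z.\<close>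

lemma shift_surj:
  assumes "\<not> eig z" "u \<in> Lam"
  shows "\<exists>x\<in>Lam. cong 1 (T x - fls_const z *\<^sub>K x - u)"
proof -
  obtain p where p: "p \<noteq> 0" "annih p" using annih_exists by blast
  obtain q where q: "p = [:-z, 1:] ^ order z p * q" "\<not> [:-z, 1:] dvd q"
    using order_decomp[OF p(1)] by blast
  then have qz: "poly q z \<noteq> 0" by (simp add: poly_eq_0_iff_dvd)
  have strip: "cong 1 w" if "cong 1 (pact ([:-z, 1:] ^ e) w)" "w \<in> Lam" for e w
    using that
  proof (induction e arbitrary: w)
    case 0
    then show ?case by (simp add: one_pCons pact_pCons)
  next
    case (Suc e)
    have "pact ([:-z, 1:] ^ Suc e) w = pact ([:-z, 1:] ^ e) (T w - fls_const z *\<^sub>K w)"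
      by (simp only: power_Suc2 pact_mult pact_linear_factor)
    with Suc have "cong 1 (T w - fls_const z *\<^sub>K w)" using Lam_T_shift by metis
    with assms(1) Suc.prems(2) show ?case by (auto simp: eig_def)
  qed
  have "cong 1 (pact ([:-z, 1:] ^ order z p) (pact q u))"
    using annih_cong[OF p(2) assms(2)] by (simp add: q(1)[symmetric] flip: pact_mult)
  then have qu: "cong 1 (pact q u)" using strip Lam_pact[OF assms(2)] by blast
  define r where "r = synthetic_div q z"
  define x where "x = fls_const (- inverse (poly q z)) *\<^sub>K pact r u"
  have "q = [:-z, 1:] * r + [:poly q z:]"
    unfolding r_def by (rule synthetic_div_correct'[symmetric])
  then have "pact q u = pact ([:-z, 1:] * r + [:poly q z:]) u" by (rule arg_cong)
  then have "pact q u = T (pact r u) - fls_const z *\<^sub>K pact r u + fls_const (poly q z) *\<^sub>K u"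
    by (simp only: pact_add pact_mult pact_linear_factor pact_const)
  then have "fls_const (- inverse (poly q z)) *\<^sub>K pact q u = T x - fls_const z *\<^sub>K x - u"
    using qz unfolding x_def
    by (simp add: T_const T_uminus fls_vs.scale_right_diff_distrib fls_vs.scale_right_distrib
        fls_const_mult_const fls_vs.scale_left_commute[of "fls_const z"] mult.commute)
  then have "cong 1 (T x - fls_const z *\<^sub>K x - u)" using cong_const[OF qu] by metis
  moreover have "x \<in> Lam" unfolding x_def using assms(2) by (intro Lam_const Lam_pact)
  ultimately show ?thesis by blast
qed

text \<open>An eigenvector modulo \<open>b Lam + U\<close> lifts order by order in \<open>b\<close> as soon as no later
  shift of its eigenvalue is again an eigenvalue.\<close>
lemma eig_lift:
  assumes "eig z"
  shows "\<exists>n::nat. \<exists>v. v \<notin> U \<and> T v - fls_const (z + of_nat n) *\<^sub>K v \<in> U"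
proof -
  obtain p where p: "p \<noteq> 0" "annih p" using annih_exists by blast
  define R where "R = {n::nat. eig (z + of_nat n)}"
  have "(\<lambda>n. z + of_nat n) ` R \<subseteq> {w. poly p w = 0}" using eig_root p by (auto simp: R_def)
  then have "finite ((\<lambda>n. z + of_nat n) ` R)" using poly_roots_finite[OF p(1)] finite_subset by blast
  moreover have "inj_on (\<lambda>n. z + of_nat n :: complex) R" by (auto simp: inj_on_def)
  ultimately have "finite R" by (simp add: finite_image_iff)
  moreover have "0 \<in> R" using assms by (simp add: R_def)
  ultimately have n: "Max R \<in> R" and max: "\<And>k. k \<in> R \<Longrightarrow> k \<le> Max R"
    using Max_in[of R] Max_ge[of R] by blast+
  define w where "w = z + of_nat (Max R)"
  have not_eig: "\<not> eig (w + of_nat (Suc k))" for k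
  proof
    assume "eig (w + of_nat (Suc k))"
    then have "Max R + Suc k \<in> R" by (simp add: R_def w_def ac_simps)
    from max[OF this] show False by simp
  qed
  from n obtain y where y: "y \<in> Lam" "\<not> cong 1 y" "cong 1 (T y - fls_const w *\<^sub>K y)"
    by (auto simp: R_def w_def eig_def)
  \<comment> \<open>\<open>Y k\<close> is an eigenvector up to order k + 1. Fixing the start at
    \<open>y\<close> keeps every approximation, and the limit, congruent to \<open>y\<close> modulo
    b \<open>Lam\<close>, hence outside \<open>U\<close>.\<close>
  let ?P = "\<lambda>k Y. Y \<in> Lam \<and> cong (Suc k) (T Y - fls_const w *\<^sub>K Y) \<and> (k = 0 \<longrightarrow> Y = y)"
  have "\<exists>Y. \<forall>k. ?P k (Y k) \<and> Y (Suc k) - Y k \<in> bfilt (Suc k)"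
  proof (rule dependent_nat_choice)
    show "\<exists>Y. ?P 0 Y" using y by auto
    fix Y k assume Y: "?P k Y"
    then obtain x where x: "x \<in> bfilt (Suc k)" "T Y - fls_const w *\<^sub>K Y - x \<in> U"
      by (auto simp: cong_def)
    then obtain u where u: "u \<in> Lam" "x = bpow (int (Suc k)) *\<^sub>K u" by (elim bfilt_obtain)
    \<comment> \<open>The correction is b^(k+1) x'. Taking the power of \<open>b\<close> out of
      \<open>T\<close> turns the eigenvalue \<open>w\<close> into w + k + 1, which is not an
      eigenvalue, so the equation for x' is solvable.\<close>
    obtain x' where x': "x' \<in> Lam" "cong 1 (T x' - fls_const (w + of_nat (Suc k)) *\<^sub>K x' - u)"
      using shift_surj[OF not_eig u(1)] by blast
    then obtain s where s: "s \<in> bfilt 1" "T x' - fls_const (w + of_nat (Suc k)) *\<^sub>K x' - u - s \<in> U"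
      by (auto simp: cong_def)
    then obtain s' where s': "s' \<in> Lam" "s = bpow (int 1) *\<^sub>K s'" by (elim bfilt_obtain)
    define Y' where "Y' = Y - bpow (int (Suc k)) *\<^sub>K x'"
    have bx: "bpow (int (Suc k)) *\<^sub>K x' \<in> bfilt (Suc k)" using x' by (intro bfilt_bpow) auto
    have T1: "T (bpow (int (Suc k)) *\<^sub>K x') - fls_const w *\<^sub>K bpow (int (Suc k)) *\<^sub>K x'
        = bpow (int (Suc k)) *\<^sub>K (T x' - fls_const (w + of_nat (Suc k)) *\<^sub>K x')"
      by (simp add: T_bpow fls_vs.scale_right_diff_distrib fls_vs.scale_left_distrib ring_distribs
          mult.commute fls_vs.scale_right_distrib del: of_nat_Suc flip: fls_plus_const)
    have "T Y' - fls_const w *\<^sub>K Y' = (T Y - fls_const w *\<^sub>K Y)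
        - (T (bpow (int (Suc k)) *\<^sub>K x') - fls_const w *\<^sub>K bpow (int (Suc k)) *\<^sub>K x')"
      unfolding Y'_def T_diff fls_vs.scale_right_diff_distrib by simp
    also have "\<dots> = (T Y - fls_const w *\<^sub>K Y - x)
         - bpow (int (Suc k)) *\<^sub>K (T x' - fls_const (w + of_nat (Suc k)) *\<^sub>K x' - u - s)
         - bpow (int (Suc k)) *\<^sub>K s"
      unfolding T1 u(2) fls_vs.scale_right_diff_distrib by simp
    finally have eq: "T Y' - fls_const w *\<^sub>K Y' = \<dots>" .
    have "bpow (int (Suc k)) *\<^sub>K s \<in> bfilt (Suc (Suc k))"
      using s' by (auto simp: bpow_add intro!: bfilt_bpow)
    then have "cong (Suc (Suc k)) (T Y' - fls_const w *\<^sub>K Y')"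
      unfolding eq using x s by (intro cong_diff cong_pw cong_U U_scale)
    moreover have "Y' - Y \<in> bfilt (Suc k)"
      using bfilt_diff[OF bfilt_0_mem bx] by (simp add: Y'_def)
    moreover have "Y' \<in> Lam"
      using Lam_add[of Y "Y' - Y"] Y bfilt_antimono[OF \<open>Y' - Y \<in> bfilt (Suc k)\<close>, of 0] by simp
    ultimately show "\<exists>Y'. ?P (Suc k) Y' \<and> Y' - Y \<in> bfilt (Suc k)" by blast
  qed
  then obtain Y where Y: "\<And>k. ?P k (Y k)" "\<And>k. Y (Suc k) - Y k \<in> bfilt (Suc k)" by blast
  obtain L where L: "L \<in> Lam" "\<And>k. L - Y k \<in> bfilt (Suc k)"
    using Lam_complete[of Y] Y by blast
  have "cong k (T L - fls_const w *\<^sub>K L)" for k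
  proof (rule cong_antimono)
    have "T L - fls_const w *\<^sub>K L = (T (Y k) - fls_const w *\<^sub>K Y k) +
        (T (L - Y k) - fls_const w *\<^sub>K (L - Y k))"
      by (simp add: T_diff fls_vs.scale_right_diff_distrib)
    then show "cong (Suc k) (T L - fls_const w *\<^sub>K L)"
      using Y(1)[of k] L(2)[of k] by (metis cong_add cong_pw bfilt_diff bfilt_T bfilt_const)
  qed simp
  then have "T L - fls_const w *\<^sub>K L \<in> U" by (rule closed_U)
  moreover have "L \<notin> U"
  proof
    assume "L \<in> U"
    from cong_diff[OF cong_U[OF this] cong_pw[OF L(2)[of 0, simplified]]] Y(1)[of 0] y(2)
    show False by simp
  qed
  ultimately show ?thesis unfolding w_def by blast
qed

end

section \<open>Embedding into the space of logarithmic series\<close>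

text \<open>The action of b^-1 a on the sum of the f_j e_(l,j), now with Laurent coefficients. The
  shifted term appears because b^-1 a sends e_(l,j+1) to l e_(l,j+1) + e_(l,j).\<close>

definition log_op :: "complex \<Rightarrow> (nat \<Rightarrow> complex fls) \<Rightarrow> nat \<Rightarrow> complex fls" where
  "log_op l f = (\<lambda>j. fls_const l * f j + theta (f j) + f (Suc j))"

lemma log_op_add: "log_op l (f + g) = log_op l f + log_op l g"
  by (simp add: log_op_def fun_eq_iff pointwise_simps theta_add algebra_simps)

lemma log_op_scale: "log_op l (c *\<^sub>K f) = c *\<^sub>K log_op l f + theta c *\<^sub>K f"
  by (simp add: log_op_def fun_eq_iff pointwise_simps theta_mult algebra_simps)

text \<open>At a resonant exponent \<open>n = - c\<close> the coefficient of \<open>\<xi> 0\<close> is free; prescribing it is what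
  makes the induction on \<open>J\<close> solve the resonant equation one step up the chain.\<close>
lemma log_solve:
  fixes c :: complex and r :: "complex fls"
  assumes "\<forall>j\<ge>J. \<eta> j = 0"
  shows "\<exists>\<xi>. (\<forall>j\<ge>Suc J. \<xi> j = 0) \<and> (\<forall>j. theta (\<xi> j) + fls_const c * \<xi> j + \<xi> (Suc j) = \<eta> j)
    \<and> (\<forall>n. of_int n + c = 0 \<longrightarrow> \<xi> 0 $$ n = r $$ n)"
  using assms
proof (induction J arbitrary: \<eta> r)
  \<comment> \<open>\<open>G y r\<close> inverts theta + c coefficient by coefficient; where the
    divisor vanishes, the coefficient is borrowed from \<open>r\<close>.\<close>
  define G :: "complex fls \<Rightarrow> complex fls \<Rightarrow> complex fls"
    where "G y r = Abs_fls (\<lambda>n. if of_int n + c = 0 then r $$ n else y $$ n / (of_int n + c))" for y r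
  have G: "G y r $$ n = (if of_int n + c = 0 then r $$ n else y $$ n / (of_int n + c))" for y r n
    unfolding G_def
    by (subst nth_Abs_fls_lower_bound[of "min (fls_subdegree y) (fls_subdegree r)"]) auto
  have G_eq: "theta (G y r) + fls_const c * G y r = y"
    if "\<And>n. of_int n + c = 0 \<Longrightarrow> y $$ n = 0" for y r
    using that by (intro fls_eqI) (auto simp: G simp flip: distrib_right)
  {
    case 0
    \<comment> \<open>Even for zero right-hand side the prescribed resonant coefficient needs one
      coordinate, which is why the support bound is \<open>Suc J\<close> and not
      \<open>J\<close>.\<close>
    then show ?case
      by (intro exI[of _ "\<lambda>j. if j = 0 then G 0 r else 0"]) (auto simp: G_eq G)
  next
    case (Suc J)
    from Suc.prems have "\<forall>j\<ge>J. \<eta> (Suc j) = 0" by auto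
    from Suc.IH[of "\<lambda>j. \<eta> (Suc j)" "\<eta> 0", OF this] obtain \<xi> where \<xi>:
      "\<And>j. j \<ge> Suc J \<Longrightarrow> \<xi> j = 0"
      "\<And>j. theta (\<xi> j) + fls_const c * \<xi> j + \<xi> (Suc j) = \<eta> (Suc j)"
      "\<And>n. of_int n + c = 0 \<Longrightarrow> \<xi> 0 $$ n = \<eta> 0 $$ n"
      by blast
    define \<xi>' where "\<xi>' j = (case j of 0 \<Rightarrow> G (\<eta> 0 - \<xi> 0) r | Suc i \<Rightarrow> \<xi> i)" for j
    have "theta (\<xi>' 0) + fls_const c * \<xi>' 0 = \<eta> 0 - \<xi> 0"
      unfolding \<xi>'_def using \<xi>(3) by (simp add: G_eq)
    then have "theta (\<xi>' j) + fls_const c * \<xi>' j + \<xi>' (Suc j) = \<eta> j" for j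
      by (cases j) (auto simp: \<xi>'_def \<xi>(2))
    moreover have "\<xi>' j = 0" if "j \<ge> Suc (Suc J)" for j
      using that \<xi>(1) by (cases j) (auto simp: \<xi>'_def)
    moreover have "\<xi>' 0 $$ n = r $$ n" if "of_int n + c = 0" for n
      using that by (simp add: \<xi>'_def G)
    ultimately show ?case by blast
  }
qed

lemma log_op_solve:
  assumes "\<forall>j\<ge>J. \<eta> j = 0"
  shows "\<exists>\<xi>. (\<forall>j\<ge>Suc J. \<xi> j = 0) \<and> log_op l \<xi> = fls_const \<mu> *\<^sub>K \<xi> + \<eta>"
proof -
  from log_solve[OF assms, of "l - \<mu>" 0] obtain \<xi> where
    \<xi>: "\<forall>j\<ge>Suc J. \<xi> j = 0" "\<And>j. theta (\<xi> j) + fls_const (l - \<mu>) * \<xi> j + \<xi> (Suc j) = \<eta> j"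
    by blast
  have "fls_const l * \<xi> j + theta (\<xi> j) + \<xi> (Suc j) = fls_const \<mu> * \<xi> j + \<eta> j" for j
    unfolding \<xi>(2)[symmetric] by (simp add: algebra_simps flip: fls_minus_const)
  then have "log_op l \<xi> = fls_const \<mu> *\<^sub>K \<xi> + \<eta>"
    by (simp add: log_op_def fun_eq_iff pointwise_simps)
  with \<xi>(1) show ?thesis by blast
qed

section \<open>Embedding a space with a single eigenline, one dimension at a time\<close>

locale single_eigenline = connection_lattice N Lam m
  for N :: "('i::finite \<Rightarrow> complex fls) \<Rightarrow> 'i \<Rightarrow> complex fls" and Lam m +
  fixes w0 :: "'i \<Rightarrow> complex fls" and l :: complex
  assumes w0: "w0 \<noteq> 0" "N w0 = fls_const l *\<^sub>K w0"
    and proportional: "v \<noteq> 0 \<Longrightarrow> N v = fls_const \<mu> *\<^sub>K v \<Longrightarrow> \<exists>c. v = c *\<^sub>K w0"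
begin

text \<open>\<open>h\<close> is linear on the whole space, but compatibility with \<open>N\<close>,
  injectivity and the bound \<open>J\<close> on the powers of the logarithm are required only on
  \<open>U\<close>.\<close>

definition embeds :: "('i \<Rightarrow> complex fls) set \<Rightarrow> (('i \<Rightarrow> complex fls) \<Rightarrow> nat \<Rightarrow> complex fls) \<Rightarrow> bool" where
  "embeds U h \<longleftrightarrow> fls_vs.subspace U \<and> (\<forall>x\<in>U. N x \<in> U) \<and> w0 \<in> U
     \<and> Vector_Spaces.linear fscale fscale h \<and> (\<forall>x\<in>U. h (N x) = log_op l (h x))
     \<and> (\<forall>x\<in>U. h x = 0 \<longrightarrow> x = 0) \<and> (\<exists>J. \<forall>x\<in>U. \<forall>j\<ge>J. h x j = 0)"

text \<open>Start of the chain: \<open>w0\<close> may go to e_(l,0), because both are eigenvectors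
  with eigenvalue \<open>l\<close>.\<close>

lemma embeds_line: "\<exists>h. embeds (fls_vs.span {w0}) h"
proof -
  have "fls_vs.independent {w0}" using w0 by simp
  from fls_vs_pair.linear_independent_extend[OF this, of "\<lambda>_. unit_vec (0::nat)"]
  obtain h :: "('i \<Rightarrow> complex fls) \<Rightarrow> nat \<Rightarrow> complex fls" where
    lin: "Vector_Spaces.linear fscale fscale h" and hw: "h w0 = unit_vec 0" by auto
  interpret h: Vector_Spaces.linear fscale fscale h by fact
  have N: "N (c *\<^sub>K w0) = (c * fls_const l + theta c) *\<^sub>K w0" for c
    by (simp add: N_scale w0(2) fls_vs.scale_left_distrib)
  have log_op: "log_op l (unit_vec 0) = fls_const l *\<^sub>K unit_vec 0"
    by (auto simp: log_op_def unit_vec_def fun_eq_iff pointwise_simps)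
  have "unit_vec (0::nat) \<noteq> 0" by (auto simp: unit_vec_def fun_eq_iff pointwise_simps)
  have supp: "\<exists>J. \<forall>x\<in>fls_vs.span {w0}. \<forall>j\<ge>J. h x j = 0"
    by (intro exI[of _ 1])
      (auto simp: fls_vs.span_singleton h.scale hw unit_vec_def pointwise_simps)
  show ?thesis
    unfolding embeds_def
  proof (intro exI[of _ h] conjI ballI impI fls_vs.subspace_span lin supp)
    show "w0 \<in> fls_vs.span {w0}" by (simp add: fls_vs.span_base)
    fix x assume "x \<in> fls_vs.span {w0}"
    then obtain c where x: "x = c *\<^sub>K w0" by (auto simp: fls_vs.span_singleton)
    show "N x \<in> fls_vs.span {w0}" unfolding x N by (simp add: fls_vs.span_base fls_vs.span_scale)
    show "h (N x) = log_op l (h x)"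
      unfolding x N h.scale hw log_op_scale log_op by (simp add: fls_vs.scale_left_distrib)
    show "x = 0" if "h x = 0"
      using that \<open>unit_vec 0 \<noteq> 0\<close> by (simp add: x h.scale hw)
  qed
qed

text \<open>The log space is injective as a module over the operator: the equation for the image of the new
  basis vector is always solvable, and a kernel would contain an eigenvector outside \<open>U\<close>.\<close>
lemma embeds_extend:
  assumes "embeds U h" "U \<noteq> UNIV"
  shows "\<exists>v U' h'. v \<notin> U \<and> v \<in> U' \<and> U \<subseteq> U' \<and> embeds U' h'"
proof -
  from assms(1) obtain J where U: "fls_vs.subspace U" "\<And>x. x \<in> U \<Longrightarrow> N x \<in> U" "w0 \<in> U"
    and lin: "Vector_Spaces.linear fscale fscale h"
    and hN: "\<And>x. x \<in> U \<Longrightarrow> h (N x) = log_op l (h x)" and inj: "\<And>x. x \<in> U \<Longrightarrow> h x = 0 \<Longrightarrow> x = 0"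
    and J: "\<And>x j. x \<in> U \<Longrightarrow> j \<ge> J \<Longrightarrow> h x j = 0"
    unfolding embeds_def by blast
  interpret S: connection_lattice_sub N Lam m U
    by unfold_locales (use U in auto)
  obtain z0 where "S.eig z0" using S.eig_exists assms(2) by blast
  from S.eig_lift[OF this] obtain z v where v: "v \<notin> U" "T v - fls_const z *\<^sub>K v \<in> U"
    by blast
  define \<mu> where "\<mu> = - z"
  define u where "u = N v - fls_const \<mu> *\<^sub>K v"
  have "u = - (T v - fls_const z *\<^sub>K v)" by (simp add: u_def \<mu>_def T_def)
  then have u: "u \<in> U" using v(2) fls_vs.subspace_neg[OF U(1)] by metis
  have Nv: "N v = fls_const \<mu> *\<^sub>K v + u" by (simp add: u_def)
  \<comment> \<open>The image \<open>\<xi>\<close> of \<open>v\<close> has to satisfy the relation N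
    v = \<mu> v + u with \<open>u\<close> replaced by its image.\<close>
  from log_op_solve[of J "h u" l \<mu>] J[OF u] obtain \<xi>
    where \<xi>: "\<And>j. j \<ge> Suc J \<Longrightarrow> \<xi> j = 0" "log_op l \<xi> = fls_const \<mu> *\<^sub>K \<xi> + h u" by blast
  obtain B where B: "B \<subseteq> U" "fls_vs.independent B" "U \<subseteq> fls_vs.span B"
    using fls_vs.maximal_independent_subset by blast
  have spanB: "fls_vs.span B = U" using B U(1) by (simp add: fls_vs.span_minimal subset_antisym)
  have "fls_vs.independent (insert v B)"
    using v(1) B spanB by (intro fls_vs.independent_insertI) auto
  from fls_vs_pair.linear_independent_extend[OF this, of "\<lambda>x. if x = v then \<xi> else h x"]
  obtain g where g: "\<forall>x\<in>insert v B. g x = (if x = v then \<xi> else h x)"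
    and ling: "Vector_Spaces.linear fscale fscale g" by blast
  interpret h: Vector_Spaces.linear fscale fscale h by fact
  interpret g: Vector_Spaces.linear fscale fscale g by fact
  have "v \<notin> B" using v B by auto
  then have gB: "\<And>b. b \<in> B \<Longrightarrow> g b = h b" using g by auto
  have gU: "g x = h x" if "x \<in> U" for x
    using fls_vs_pair.linear_eq_on[OF ling lin, of x B] gB that spanB by auto
  have gv: "g v = \<xi>" using g by auto
  define U' where "U' = fls_vs.span (insert v B)"
  have U'_iff: "x \<in> U' \<longleftrightarrow> (\<exists>c y. y \<in> U \<and> x = c *\<^sub>K v + y)" for x
  proof
    assume "x \<in> U'"
    then obtain c where "x - c *\<^sub>K v \<in> U" by (auto simp: U'_def fls_vs.span_insert spanB)
    then show "\<exists>c y. y \<in> U \<and> x = c *\<^sub>K v + y"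
      by (intro exI[of _ c] exI[of _ "x - c *\<^sub>K v"]) simp
  next
    assume "\<exists>c y. y \<in> U \<and> x = c *\<^sub>K v + y"
    then obtain c y where "y \<in> U" "x = c *\<^sub>K v + y" by blast
    then have "x - c *\<^sub>K v \<in> U" by simp
    then show "x \<in> U'" by (auto simp: U'_def fls_vs.span_insert spanB)
  qed
  have gmul: "g (c *\<^sub>K v + y) = c *\<^sub>K \<xi> + h y" if "y \<in> U" for c y
    using gU[OF that] by (simp add: g.add g.scale gv)
  have Nmul: "N (c *\<^sub>K v + y) = (c * fls_const \<mu> + theta c) *\<^sub>K v + (c *\<^sub>K u + N y)" for c y
    by (simp add: N_add N_scale Nv fls_vs.scale_left_distrib fls_vs.scale_right_distrib ac_simps)
  have Ny: "c *\<^sub>K u + N y \<in> U" if "y \<in> U" for c y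
    using that u U by (intro S.U_add S.U_scale) auto
  have stable: "N x \<in> U'" if "x \<in> U'" for x
    using that Ny unfolding U'_iff by (metis Nmul)
  have equiv: "g (N x) = log_op l (g x)" if "x \<in> U'" for x
  proof -
    from that obtain c y where y: "y \<in> U" "x = c *\<^sub>K v + y" by (auto simp: U'_iff)
    have "g (N x) = (c * fls_const \<mu> + theta c) *\<^sub>K \<xi> + (c *\<^sub>K h u + log_op l (h y))"
      unfolding y(2) Nmul gmul[OF Ny[OF y(1)]] by (simp add: h.add h.scale hN y(1))
    also have "\<dots> = log_op l (g x)"
      unfolding y(2) gmul[OF y(1)] log_op_add log_op_scale \<xi>(2)
      by (simp add: fls_vs.scale_left_distrib fls_vs.scale_right_distrib ac_simps)
    finally show ?thesis .
  qed
  have inj': "x = 0" if "x \<in> U'" "g x = 0" for x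
  proof -
    from that obtain c y where y: "y \<in> U" "x = c *\<^sub>K v + y" by (auto simp: U'_iff)
    show ?thesis
    proof (cases "c = 0")
      case True
      with y that gU inj show ?thesis by auto
    next
      case False
      \<comment> \<open>Scale the kernel element to v + y'. Its defect \<open>d\<close> lies in
        \<open>U\<close> and in the kernel of \<open>g\<close>, so it is zero and v + y' is an
        eigenvector. It then lies on the line of \<open>w0\<close>, inside \<open>U\<close>, which
        contradicts the choice of \<open>v\<close>.\<close>
      define y' where "y' = inverse c *\<^sub>K y"
      have y': "y' \<in> U" unfolding y'_def using y by (intro S.U_scale)
      have x: "v + y' = inverse c *\<^sub>K x"
        using False by (simp add: y(2) y'_def fls_vs.scale_right_distrib)
      then have g0: "g (v + y') = 0" using that by (simp add: g.scale)
      have mem: "v + y' \<in> U'" using U'_iff[of "v + y'"] y' by (metis fls_vs.scale_one)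
      define d where "d = N (v + y') - fls_const \<mu> *\<^sub>K (v + y')"
      have "d = u + N y' - fls_const \<mu> *\<^sub>K y'"
        by (simp add: d_def N_add Nv fls_vs.scale_right_distrib)
      then have dU: "d \<in> U" using u y' U by (auto intro!: S.U_diff S.U_add S.U_scale)
      have log_op0: "log_op l 0 = 0" by (simp add: log_op_def fun_eq_iff pointwise_simps)
      have "g d = 0"
        unfolding d_def g.diff g.scale equiv[OF mem] by (simp add: g0 log_op0)
      then have "d = 0" using inj[OF dU] gU[OF dU] by simp
      then have eig: "N (v + y') = fls_const \<mu> *\<^sub>K (v + y')" by (simp add: d_def)
      have "v + y' \<in> U \<Longrightarrow> False" using S.U_diff[OF _ y', of "v + y'"] v(1) by simp
      moreover have "v + y' \<noteq> 0" using calculation S.U_0 by metis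
      from proportional[OF this eig] U(3) have "v + y' \<in> U" by (auto intro: S.U_scale)
      ultimately show ?thesis by blast
    qed
  qed
  have supp: "g x j = 0" if "x \<in> U'" "j \<ge> Suc J" for x j
  proof -
    from that obtain c y where y: "y \<in> U" "x = c *\<^sub>K v + y" by (auto simp: U'_iff)
    show ?thesis using that(2) \<xi>(1)[of j] J[OF y(1), of j]
      unfolding y(2) gmul[OF y(1)] by (simp add: pointwise_simps)
  qed
  have "v \<in> U'" "U \<subseteq> U'"
    unfolding U'_def using spanB fls_vs.span_mono[of B "insert v B"]
    by (auto intro: fls_vs.span_base)
  moreover have "embeds U' g"
    unfolding embeds_def
  proof (intro conjI)
    show "fls_vs.subspace U'" unfolding U'_def by (rule fls_vs.subspace_span)
  qed (use stable equiv inj' supp ling \<open>U \<subseteq> U'\<close> U(3) in blast)+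
  ultimately show ?thesis using v(1) by blast
qed

text \<open>Each extension step enlarges an independent subset of \<open>U\<close> by one vector;
  since such sets have bounded size, the chain reaches the whole space.\<close>

lemma embeds_UNIV: "\<exists>h. embeds UNIV h"
proof -
  have "\<exists>U h. embeds U h \<and> (U = UNIV \<or> (\<exists>B\<subseteq>U. fls_vs.independent B \<and> card B = k))" for k
  proof (induction k)
    case 0
    show ?case using embeds_line by (metis card.empty empty_subsetI fls_vs.independent_empty)
  next
    case (Suc k)
    then obtain U h where U: "embeds U h"
      and "U = UNIV \<or> (\<exists>B\<subseteq>U. fls_vs.independent B \<and> card B = k)" by blast
    then consider "U = UNIV"
      | B where "U \<noteq> UNIV" "B \<subseteq> U" "fls_vs.independent B" "card B = k" by blast
    then show ?case
    proof cases
      case 1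
      with U show ?thesis by blast
    next
      case 2
      from embeds_extend[OF U 2(1)] obtain v U' h'
        where v: "v \<notin> U" "v \<in> U'" "U \<subseteq> U'" "embeds U' h'" by blast
      have "fls_vs.span B \<subseteq> U" using U 2(2) by (intro fls_vs.span_minimal) (auto simp: embeds_def)
      then have "fls_vs.independent (insert v B)"
        using v(1) 2(3) by (intro fls_vs.independent_insertI) auto
      moreover have "card (insert v B) = Suc k"
        using 2 v(1) independent_card_bound[OF 2(3)] by (subst card_insert_disjoint) auto
      ultimately show ?thesis using v 2(2) by (metis insert_subset order_trans)
    qed
  qed
  from this[of "Suc (card (UNIV :: 'i set))"] obtain U h where "embeds U h"
    "U = UNIV \<or> (\<exists>B\<subseteq>U. fls_vs.independent B \<and> card B = Suc (card (UNIV :: 'i set)))" by blast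
  with independent_card_bound show ?thesis by (metis Suc_n_not_le_n)
qed

text \<open>On a leading polar coefficient vector of order \<open>D > 0\<close>, the operator \<open>- N\<close> acts triangularly
  with eigenvalue \<open>D - l\<close>, which must therefore be a root of every annihilating polynomial.\<close>
lemma embedding_no_poles:
  assumes h: "embeds UNIV h" and p: "annih p"
    and roots: "\<And>D::nat. D > 0 \<Longrightarrow> poly p (of_nat D - l) \<noteq> 0"
    and y: "y \<in> Lam"
  shows "h y \<in> val_ge 0"
proof -
  from h obtain J where lin: "Vector_Spaces.linear fscale fscale h"
    and hN: "\<And>x. h (N x) = log_op l (h x)" and J: "\<And>x j. j \<ge> J \<Longrightarrow> h x j = 0"
    unfolding embeds_def by blast
  interpret h: Vector_Spaces.linear fscale fscale h by fact
  have bound: "\<exists>k::nat. x \<in> val_ge (- int k)" if "\<And>j. j \<ge> J \<Longrightarrow> x j = 0" for x :: "nat \<Rightarrow> complex fls"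
  proof -
    define k where "k = Max (insert 0 ((\<lambda>j. nat (- fls_subdegree (x j))) ` {..<J}))"
    have "x j $$ n = 0" if "n < - int k" for j n
    proof (cases "j < J")
      case True
      then have "nat (- fls_subdegree (x j)) \<le> k" unfolding k_def by (intro Max_ge) auto
      with that show ?thesis by (intro fls_eq0_below_subdegree) linarith
    qed (use \<open>\<And>j. j \<ge> J \<Longrightarrow> x j = 0\<close> in auto)
    then show ?thesis by (auto simp: val_ge_def)
  qed
  have "\<forall>i. \<exists>k. h (unit_vec i) \<in> val_ge (- int k)" using bound J by blast
  then obtain k where "\<And>i. h (unit_vec i) \<in> val_ge (- int (k i))" by metis
  from linear_val_ge[OF lin this] obtain K
    where K: "\<And>d y. y \<in> val_ge d \<Longrightarrow> h y \<in> val_ge (d - int K)" by blast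
  \<comment> \<open>A uniform bound on the pole orders over all of \<open>h\<close> applied to
    \<open>Lam\<close>; the least such bound \<open>D\<close> is shown to be 0.\<close>
  define Q where "Q D \<longleftrightarrow> (\<forall>x\<in>Lam. h x \<in> val_ge (- int D))" for D :: nat
  have "Q (m + K)" using K Lam_upper unfolding Q_def by fastforce
  define D where "D = (LEAST D. Q D)"
  have D: "Q D" unfolding D_def by (rule LeastI) fact
  have "D = 0"
  proof (rule ccontr)
    assume "D \<noteq> 0"
    then obtain D' where D': "D = Suc D'" by (cases D) auto
    then have "\<not> Q D'" using not_less_Least[of D' Q] unfolding D_def by simp
    then obtain x i n where x: "x \<in> Lam" "n < - int D'" "h x i $$ n \<noteq> 0"
      by (auto simp: Q_def val_ge_def)
    have "n \<ge> - int D" using D x by (force simp: Q_def val_ge_def)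
    with x(2) D' have n: "n = - int D" by simp
    define S where "S = {i. h x i $$ n \<noteq> 0}"
    have "S \<subseteq> {..<J}" unfolding S_def using J by (auto simp: not_less) (metis fls_zero_nth not_le)
    then have "finite S" by (rule finite_subset) simp
    \<comment> \<open>At the highest logarithmic index with a pole of exact order \<open>D\<close>,
      the term coming from \<open>Suc j\<close> vanishes, so \<open>T\<close> acts on this
      coefficient by a scalar.\<close>
    define j where "j = Max S"
    have "j \<in> S" unfolding j_def using \<open>finite S\<close> x(3) by (intro Max_in) (auto simp: S_def)
    have above: "h x i $$ n = 0" if "i > j" for i
      using Max_ge[OF \<open>finite S\<close>, of i] that by (force simp: S_def j_def)
    have hT: "h (T w) i $$ n = (of_nat D - l) * h w i $$ n - h w (Suc i) $$ n" for w i
      unfolding T_def h.neg hN log_op_def by (simp add: pointwise_simps n algebra_simps)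
    have "(\<forall>i>j. h (pact q x) i $$ n = 0) \<and>
        h (pact q x) j $$ n = poly q (of_nat D - l) * h x j $$ n" for q
    proof (induction q)
      case 0
      show ?case unfolding pact_0 h.zero by (simp add: zero_fun_apply)
    next
      case (pCons a q)
      have step: "h (pact (pCons a q) x) i $$ n = a * h x i $$ n
          + ((of_nat D - l) * h (pact q x) i $$ n - h (pact q x) (Suc i) $$ n)" for i
        unfolding pact_pCons h.add h.scale by (simp add: pointwise_simps hT)
      show ?case using pCons.IH above by (simp add: step algebra_simps)
    qed
    then have "h (pact p x) j $$ n = poly p (of_nat D - l) * h x j $$ n" by blast
    also have "\<dots> \<noteq> 0" using roots[of D] \<open>D \<noteq> 0\<close> \<open>j \<in> S\<close> by (simp add: S_def)
    finally have nz: "h (pact p x) j $$ n \<noteq> 0" .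
    \<comment> \<open>An element of b \<open>Lam\<close> has an image with poles of order at most D
      - 1, so its coefficient at - D must vanish.\<close>
    from p x(1) have "pact p x \<in> bfilt 1" by (auto simp: annih_def)
    then obtain w where w: "w \<in> Lam" "pact p x = bpow (int 1) *\<^sub>K w" by (elim bfilt_obtain)
    have "h w j $$ (n - 1) = 0" using D w(1) by (auto simp: Q_def val_ge_def n)
    then have "h (pact p x) j $$ n = 0" unfolding w(2) h.scale by (simp add: pointwise_simps)
    with nz show False by simp
  qed
  with D y show ?thesis by (simp add: Q_def)
qed

end

section \<open>The localisation of an (a,b)-module\<close>

lemma binv_a_apply:
  "binv_a M y i = fls_X_inv * (\<Sum>j\<in>UNIV. y j * fps_to_fls (M j i)) + theta (y i)"
  unfolding theta_def by (subst fls_X_inv_X2[symmetric]) (simp add: binv_a_def aL_def distrib_left)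

lemma binv_a_add: "binv_a M (x + y) = binv_a M x + binv_a M y"
  by (simp add: binv_a_apply fun_eq_iff pointwise_simps sum.distrib theta_add algebra_simps)

lemma binv_a_scale: "binv_a M (c *\<^sub>K y) = c *\<^sub>K binv_a M y + theta c *\<^sub>K y"
proof
  fix i
  have "(\<Sum>j\<in>UNIV. c * y j * fps_to_fls (M j i)) = c * (\<Sum>j\<in>UNIV. y j * fps_to_fls (M j i))"
    by (simp add: sum_distrib_left mult.assoc)
  then show "binv_a M (c *\<^sub>K y) i = (c *\<^sub>K binv_a M y + theta c *\<^sub>K y) i"
    by (simp add: binv_a_apply pointwise_simps theta_mult algebra_simps)
qed

lemma connection_binv_a: "connection (binv_a M)"
  by unfold_locales (rule binv_a_add binv_a_scale)+

lemma aL_eq: "aL M y = fls_X *\<^sub>K binv_a M y"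
  by (simp add: binv_a_def fun_eq_iff pointwise_simps fls_X_eq_bpow fls_X_inv_eq_bpow bpow_add
      flip: mult.assoc)

lemma aL_liftL: "aL M (liftL x) = liftL (aE M x)"
proof -
  have sum: "fps_to_fls (\<Sum>j\<in>A. g j) = (\<Sum>j\<in>A. fps_to_fls (g j))" for A :: "'b set" and g :: "'b \<Rightarrow> complex fps"
    by (induction A rule: infinite_finite_induct) auto
  show ?thesis
    by (simp add: aL_def liftL_def aE_def fun_eq_iff sum fls_times_fps_to_fls fls_deriv_fps_to_fls
        fps_to_fls_power)
qed

lemma liftL_inject: "liftL x = liftL y \<longleftrightarrow> x = y"
  by (auto simp: liftL_def fun_eq_iff)

lemma liftL_add: "liftL (x + y) = liftL x + liftL y"
  by (simp add: liftL_def fun_eq_iff pointwise_simps)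

lemma liftL_smE: "liftL (smE S x) = fps_to_fls S *\<^sub>K liftL x"
  by (simp add: liftL_def smE_def fun_eq_iff pointwise_simps fls_times_fps_to_fls)

lemma liftL_0: "liftL x = 0 \<longleftrightarrow> x = 0"
  by (simp add: liftL_def fun_eq_iff pointwise_simps)

section \<open>The saturation as a lattice, and its Bernstein polynomial\<close>

lemma fps_span_add: "x \<in> fps_span smL S \<Longrightarrow> y \<in> fps_span smL S \<Longrightarrow> x + y \<in> fps_span smL S"
proof -
  assume "x \<in> fps_span smL S" "y \<in> fps_span smL S"
  then obtain n n' :: nat and c v c' v' where
    x: "\<forall>k<n. v k \<in> S" "x = (\<Sum>k<n. smL (c k) (v k))" and
    y: "\<forall>k<n'. v' k \<in> S" "y = (\<Sum>k<n'. smL (c' k) (v' k))"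
    unfolding fps_span_def by blast
  define w where "w k = (if k < n then v k else v' (k - n))" for k
  define d where "d k = (if k < n then c k else c' (k - n))" for k
  have "(\<Sum>k<n + n'. smL (d k) (w k)) = (\<Sum>k<n. smL (d k) (w k)) + (\<Sum>k<n'. smL (d (n + k)) (w (n + k)))"
    by (induction n') (simp_all add: add.assoc)
  also have "\<dots> = x + y" by (simp add: x y d_def w_def)
  finally have "x + y = (\<Sum>k<n + n'. smL (d k) (w k))" by simp
  moreover have "\<forall>k<n + n'. w k \<in> S" using x(1) y(1) by (auto simp: w_def)
  ultimately show ?thesis unfolding fps_span_def by blast
qed

lemma fps_span_0: "0 \<in> fps_span smL S"
  unfolding fps_span_def by (auto intro!: exI[of _ 0])

lemma fps_span_sum: "(\<And>k. k \<in> A \<Longrightarrow> f k \<in> fps_span smL S) \<Longrightarrow> (\<Sum>k\<in>A. f k) \<in> fps_span smL S"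
  by (induction A rule: infinite_finite_induct) (auto intro: fps_span_0 fps_span_add)

lemma fps_span_base: "x \<in> S \<Longrightarrow> smL c x \<in> fps_span smL S"
  unfolding fps_span_def by (auto intro!: exI[of _ 1] exI[of _ "\<lambda>_. c"] exI[of _ "\<lambda>_. x"])

lemma fps_span_scale: "x \<in> fps_span smL S \<Longrightarrow> smL c x \<in> fps_span smL S"
proof -
  assume "x \<in> fps_span smL S"
  then obtain n :: nat and d v where x: "\<forall>k<n. v k \<in> S" "x = (\<Sum>k<n. smL (d k) (v k))"
    unfolding fps_span_def by blast
  have "smL c x = (\<Sum>k<n. smL (c * d k) (v k))"
    unfolding x(2) by (simp add: smL_eq fls_vs.scale_sum_right fls_times_fps_to_fls)
  also have "\<dots> \<in> fps_span smL S" using x(1) by (intro fps_span_sum fps_span_base) auto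
  finally show ?thesis .
qed

text \<open>The module E' supplied by regularity is stable under b^-1 a and contains
  \<open>E\<close>, hence contains the saturation; a finite basis of E' bounds the poles.\<close>

lemma saturation_lattice:
  assumes "regular M"
  shows "\<exists>m. connection_lattice (binv_a M) (saturation M) m"
proof -
  interpret connection "binv_a M" by (rule connection_binv_a)
  from assms obtain E' where E': "range liftL \<subseteq> E'" "is_ab_module smL (aL M) E'"
    "aL M ` E' \<subseteq> smL fps_X ` E'" by (auto simp: regular_def)
  from E'(2) obtain r where E'_0: "0 \<in> E'" and E'_add: "\<And>x y. x \<in> E' \<Longrightarrow> y \<in> E' \<Longrightarrow> x + y \<in> E'"
    and E'_sm: "\<And>S x. x \<in> E' \<Longrightarrow> smL S x \<in> E'" and "free_of_rank smL E' r"
    by (auto simp: is_ab_module_def)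
  then obtain e where e: "\<And>x. x \<in> E' \<Longrightarrow> \<exists>c. x = (\<Sum>k<r. smL (c k) (e k))"
    unfolding free_of_rank_def by blast
  have E'_N: "binv_a M x \<in> E'" if "x \<in> E'" for x
  proof -
    from that E'(3) obtain y where y: "y \<in> E'" "aL M x = smL fps_X y" by blast
    then have "fls_X *\<^sub>K binv_a M x = fls_X *\<^sub>K y" by (simp add: aL_eq smL_eq)
    then have "binv_a M x = y" by (simp add: fls_X_eq_bpow)
    with y show ?thesis by simp
  qed
  have iter: "(binv_a M ^^ k) ` range liftL \<subseteq> E'" for k
  proof (induction k)
    case (Suc k)
    then show ?case using E'_N by (auto simp: image_subset_iff)
  qed (use E'(1) in auto)
  have sat_E': "saturation M \<subseteq> E'"
  proof
    fix x assume "x \<in> saturation M"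
    then obtain n :: nat and c v where v: "\<forall>k<n. v k \<in> (\<Union>k. (binv_a M ^^ k) ` range liftL)"
      and x: "x = (\<Sum>k<n. smL (c k) (v k))"
      unfolding saturation_def fps_span_def by blast
    have "v k \<in> E'" if "k < n" for k using v that iter by blast
    then show "x \<in> E'" unfolding x
      by (induction n) (auto simp: E'_0 intro!: E'_add E'_sm)
  qed
  have "\<forall>k. \<exists>d. e k \<in> val_ge (- int d)" using val_ge_exists by blast
  then obtain d where d: "\<And>k. e k \<in> val_ge (- int (d k))" by metis
  define m where "m = (\<Sum>k<r. d k)"
  have upper: "x \<in> val_ge (- int m)" if "x \<in> E'" for x
  proof -
    have sum: "(\<Sum>k\<in>A. f k) \<in> val_ge q" if "\<And>k. k \<in> A \<Longrightarrow> f k \<in> val_ge q" "finite A"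
      for A :: "nat set" and f :: "nat \<Rightarrow> 'a \<Rightarrow> complex fls" and q
      using that(2,1) by (induction) (auto intro!: val_ge_add, simp add: val_ge_def pointwise_simps)
    from e[OF that] obtain c where "x = (\<Sum>k<r. smL (c k) (e k))" by blast
    moreover have "smL (c k) (e k) \<in> val_ge (- int m)" if "k < r" for k
      unfolding smL_eq
    proof (intro val_ge_fps val_ge_mono[OF d])
      have "d k \<le> m" unfolding m_def by (rule member_le_sum) (use that in auto)
      then show "- int m \<le> - int (d k)" by simp
    qed
    ultimately show ?thesis by (auto intro!: sum)
  qed
  have base: "x \<in> saturation M" if "x \<in> (binv_a M ^^ k) ` range liftL" for x k
    using fps_span_base[of x "\<Union>k. (binv_a M ^^ k) ` range liftL" 1] that
    unfolding saturation_def smL_eq by simp blast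
  have stable: "binv_a M x \<in> saturation M" if x: "x \<in> saturation M" for x
  proof -
    from x obtain n :: nat and c v where v: "\<forall>k<n. v k \<in> (\<Union>k. (binv_a M ^^ k) ` range liftL)"
      and x: "x = (\<Sum>k<n. smL (c k) (v k))"
      unfolding saturation_def fps_span_def by blast
    have "binv_a M x = - T x" by (simp add: T_def)
    also have "\<dots> = (\<Sum>k<n. binv_a M (smL (c k) (v k)))"
      unfolding x T_sum by (simp add: T_def flip: sum_negf)
    also have "\<dots> = (\<Sum>k<n. smL (c k) (binv_a M (v k)) + smL (fps_X * fps_deriv (c k)) (v k))"
      by (simp add: smL_eq N_scale theta_def fls_times_fps_to_fls fls_deriv_fps_to_fls)
    also have "\<dots> \<in> saturation M"
      unfolding saturation_def
    proof (intro fps_span_sum fps_span_add fps_span_base)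
      fix k assume "k \<in> {..<n}"
      with v obtain j where j: "v k \<in> (binv_a M ^^ j) ` range liftL" by blast
      then have "binv_a M (v k) \<in> (binv_a M ^^ Suc j) ` range liftL" by auto
      then show "binv_a M (v k) \<in> (\<Union>k. (binv_a M ^^ k) ` range liftL)" by blast
    qed (use v in auto)
    finally show ?thesis .
  qed
  have "connection_lattice (binv_a M) (saturation M) m"
  proof unfold_locales
    show "val_ge 0 \<subseteq> saturation M" using base[of _ 0] by (auto simp: val_ge_0_eq)
    show "saturation M \<subseteq> val_ge (- int m)" using upper sat_E' by blast
  qed (use stable in \<open>auto simp: saturation_def intro: fps_span_add fps_span_scale\<close>)
  then show ?thesis by blast
qed

lemma annihilates_iff:
  assumes "connection_lattice (binv_a M) (saturation M) m"
  shows "annihilates M p \<longleftrightarrow> connection_lattice.annih (binv_a M) (saturation M) p"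
proof -
  interpret connection_lattice "binv_a M" "saturation M" m by fact
  have "(\<lambda>z. - binv_a M z) = T" by (simp add: fun_eq_iff T_def)
  then show ?thesis by (simp add: annihilates_def annih_def bfilt_1_eq)
qed

text \<open>Existence and uniqueness of the minimal annihilator turn the definite description into
  usable properties.\<close>

lemma bernstein_minimal:
  assumes "connection_lattice (binv_a M) (saturation M) m"
  shows "lead_coeff (bernstein M) = 1" "annihilates M (bernstein M)"
    and "annihilates M q \<Longrightarrow> bernstein M dvd q"
proof -
  interpret connection_lattice "binv_a M" "saturation M" m by fact
  from theI'[OF minimal_annih]
  have "lead_coeff (bernstein M) = 1 \<and> annihilates M (bernstein M) \<and> (\<forall>q. annihilates M q \<longrightarrow> bernstein M dvd q)"
    unfolding bernstein_def annihilates_iff[OF assms] .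
  then show "lead_coeff (bernstein M) = 1" "annihilates M (bernstein M)"
    "annihilates M q \<Longrightarrow> bernstein M dvd q" by auto
qed

section \<open>Eigenvectors and normal submodules of rank one\<close>

lemma fls_exists_shift_fps:
  assumes "(v :: 'i::finite \<Rightarrow> complex fls) \<noteq> 0"
  obtains x n where "v = bpow n *\<^sub>K liftL x" "x \<notin> range (smE fps_X)"
proof -
  obtain k where k: "v \<in> val_ge (- int k)" using val_ge_exists by blast
  define P where "P n \<longleftrightarrow> v \<in> val_ge (int n - int k)" for n
  have "\<exists>n. \<not> P n"
  proof (rule ccontr)
    assume "\<not> ?thesis"
    then have "P (d + k)" for d by blast
    then have "v \<in> val_ge (int d)" for d by (simp add: P_def)
    then have "v = 0" by (rule val_ge_all_eq_0)
    with assms show False by simp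
  qed
  moreover have "P 0" using k by (simp add: P_def)
  ultimately obtain n where n: "P n" "\<not> P (Suc n)"
    by (metis nat_induct)
  define e where "e = int n - int k"
  have "bpow (- e) *\<^sub>K v \<in> val_ge 0" using n(1) by (simp add: P_def e_def)
  then obtain x where x: "bpow (- e) *\<^sub>K v = liftL x" by (auto simp: val_ge_0_eq)
  have v: "v = bpow e *\<^sub>K liftL x" by (simp add: bpow_add flip: x)
  moreover have "x \<notin> range (smE fps_X)"
  proof
    assume "x \<in> range (smE fps_X)"
    then obtain y where "x = smE fps_X y" by blast
    then have "v = bpow (e + 1) *\<^sub>K liftL y"
      by (simp add: v liftL_smE fls_X_eq_bpow bpow_add)
    moreover have "liftL y \<in> val_ge 0" by (simp add: val_ge_0_eq)
    ultimately have "v \<in> val_ge (e + 1)" by (simp add: val_ge_mono)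
    with n(2) show False by (simp add: P_def e_def algebra_simps)
  qed
  ultimately show ?thesis using that by blast
qed

text \<open>After scaling, the line is spanned by some \<open>x0\<close> in \<open>E\<close> but not
  in b \<open>E\<close>. A coordinate of \<open>x0\<close> is then a unit, so every multiple of
  \<open>x0\<close> in \<open>E\<close> has a power series factor and \<open>x0\<close> is a basis.
  Normality holds because a line over the Laurent field is closed under division by
  \<open>b\<close>.\<close>

lemma eigenline_normal_sub:
  assumes v: "v \<noteq> 0" and Nv: "binv_a M v = fls_const \<mu> *\<^sub>K v"
  defines "F \<equiv> {x. \<exists>c. liftL x = c *\<^sub>K v}"
  shows "is_ab_module smE (aE M) F \<and> free_of_rank smE F 1 \<and> normal_sub F"
proof -
  obtain x0 n where x0: "v = bpow n *\<^sub>K liftL x0" "x0 \<notin> range (smE fps_X)"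
    using fls_exists_shift_fps[OF v] by blast
  have gen: "\<exists>c. x = smE c x0" if "x \<in> F" for x
  proof -
    from that obtain c where c: "liftL x = c *\<^sub>K v" by (auto simp: F_def)
    define d where "d = c * bpow n"
    have d: "liftL x = d *\<^sub>K liftL x0" by (simp add: c x0(1) d_def)
    have "\<exists>i. x0 i $ 0 \<noteq> 0"
    proof (rule ccontr)
      assume *: "\<not> ?thesis"
      have "x0 i = fps_X * fps_shift 1 (x0 i)" for i
        using * by (intro fps_ext) (auto simp: fps_X_mult_nth)
      then have "x0 = smE fps_X (\<lambda>i. fps_shift 1 (x0 i))" by (simp add: smE_def fun_eq_iff)
      with x0(2) show False by blast
    qed
    then obtain i where i: "x0 i $ 0 \<noteq> 0" by blast
    have "fps_to_fls (x i) = d * fps_to_fls (x0 i)"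
      using d by (simp add: liftL_def fun_eq_iff pointwise_simps)
    then have "d = fps_to_fls (x i) * inverse (fps_to_fls (x0 i))"
      using i by (auto simp: field_simps)
    also have "inverse (fps_to_fls (x0 i)) = fps_to_fls (inverse (x0 i))"
      using i by (simp add: fls_inverse_fps_to_fls)
    finally have "d = fps_to_fls (x i * inverse (x0 i))" by (simp add: fls_times_fps_to_fls)
    then have "liftL x = liftL (smE (x i * inverse (x0 i)) x0)" by (simp add: d liftL_smE)
    then show ?thesis by (auto simp: liftL_inject)
  qed
  have x0F: "x0 \<in> F"
    unfolding F_def by (auto intro!: exI[of _ "bpow (- n)"] simp: x0(1) bpow_add)
  have rank: "free_of_rank smE F 1"
    unfolding free_of_rank_def
  proof (intro exI[of _ "\<lambda>_. x0"] conjI allI ballI impI)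
    fix c :: "nat \<Rightarrow> complex fps" and k assume *: "(\<Sum>k<1::nat. smE (c k) x0) = 0" and "k < (1::nat)"
    have "x0 \<noteq> 0" using x0(1) v by (auto simp: liftL_0)
    then obtain i where "x0 i \<noteq> 0" by (auto simp: fun_eq_iff pointwise_simps)
    with * have "c 0 = 0" by (auto simp: smE_def fun_eq_iff pointwise_simps)
    with \<open>k < 1\<close> show "c k = 0" by simp
  next
    fix x assume "x \<in> F"
    with gen obtain c where "x = smE c x0" by blast
    then show "\<exists>c. x = (\<Sum>k<1::nat. smE (c k) x0)" by (intro exI[of _ "\<lambda>_. c"]) simp
  qed (rule x0F)
  have "is_ab_module smE (aE M) F"
    unfolding is_ab_module_def
  proof (intro conjI ballI allI)
    show "0 \<in> F" unfolding F_def by (auto intro!: exI[of _ 0] simp: liftL_0)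
    show "\<exists>r. free_of_rank smE F r" using rank by blast
    fix x assume "x \<in> F"
    then obtain c where x: "liftL x = c *\<^sub>K v" by (auto simp: F_def)
    show "smE S x \<in> F" for S
      unfolding F_def using x by (auto simp: liftL_smE)
    show "x + y \<in> F" if "y \<in> F" for y
      using that x unfolding F_def by (auto simp: liftL_add simp flip: fls_vs.scale_left_distrib)
    have "liftL (aE M x) = fls_X *\<^sub>K (c *\<^sub>K fls_const \<mu> *\<^sub>K v + theta c *\<^sub>K v)"
      unfolding aL_liftL[symmetric] aL_eq x binv_a_scale Nv by simp
    also have "\<dots> = (fls_X * (c * fls_const \<mu> + theta c)) *\<^sub>K v"
      by (simp add: fls_vs.scale_left_distrib fls_vs.scale_right_distrib ring_distribs)
    finally show "aE M x \<in> F" by (auto simp: F_def)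
  qed
  moreover have "normal_sub F"
    unfolding normal_sub_def
  proof (intro set_eqI iffI)
    fix x assume "x \<in> F \<inter> range (smE fps_X)"
    then obtain y c where y: "x = smE fps_X y" "liftL x = c *\<^sub>K v" by (auto simp: F_def)
    then have eq: "bpow 1 *\<^sub>K liftL y = c *\<^sub>K v" by (simp add: liftL_smE fls_X_eq_bpow)
    have "liftL y = bpow (-1) *\<^sub>K bpow 1 *\<^sub>K liftL y" by (simp add: bpow_add)
    also have "\<dots> = (bpow (-1) * c) *\<^sub>K v" unfolding eq by simp
    finally show "x \<in> smE fps_X ` F" using y(1) by (auto simp: F_def)
  next
    fix x assume "x \<in> smE fps_X ` F"
    then show "x \<in> F \<inter> range (smE fps_X)" by (auto simp: F_def liftL_smE)
  qed
  ultimately show ?thesis using rank by blast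
qed

text \<open>Uniqueness makes both lines cut out the same submodule of \<open>E\<close>, and each
  line is recovered from it by scaling back. This is how the rank one hypothesis enters the
  argument.\<close>

lemma eigenvectors_proportional:
  assumes uniq: "\<exists>!F. is_ab_module smE (aE M) F \<and> free_of_rank smE F 1 \<and> normal_sub F"
    and v: "v \<noteq> 0" "binv_a M v = fls_const \<mu> *\<^sub>K v"
    and w: "w \<noteq> 0" "binv_a M w = fls_const \<nu> *\<^sub>K w"
  shows "\<exists>c. v = c *\<^sub>K w"
proof -
  have F: "{x. \<exists>c. liftL x = c *\<^sub>K v} = {x. \<exists>c. liftL x = c *\<^sub>K w}"
    using uniq eigenline_normal_sub[OF v] eigenline_normal_sub[OF w] by blast
  obtain x n where x: "v = bpow n *\<^sub>K liftL x" using fls_exists_shift_fps[OF v(1)] by blast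
  then have "liftL x = bpow (- n) *\<^sub>K v" by (simp add: bpow_add)
  with F obtain c where "liftL x = c *\<^sub>K w" by blast
  with x have "v = (bpow n * c) *\<^sub>K w" by simp
  then show ?thesis by blast
qed

section \<open>Themes\<close>

text \<open>The defining condition of \<open>atilde_act\<close> as a relation, so that existence and
  uniqueness of the limit can be treated separately.\<close>

definition atilde_lim :: "'v set \<Rightarrow> (complex fps \<Rightarrow> 'v::ab_group_add \<Rightarrow> 'v) \<Rightarrow> ('v \<Rightarrow> 'v)
    \<Rightarrow> (nat \<Rightarrow> complex poly) \<Rightarrow> 'v \<Rightarrow> 'v \<Rightarrow> bool" where
  "atilde_lim C sm A P x y \<longleftrightarrow> y \<in> C \<and> (\<forall>N. \<exists>z\<in>C.
      y - (\<Sum>\<nu><N. poly_op sm A (P \<nu>) (sm (fps_X ^ \<nu>) x)) = sm (fps_X ^ N) z)"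

lemma atilde_lim_diff:
  assumes "atilde_lim C sm A P x y" "atilde_lim C sm A P x y'"
  shows "\<exists>z z'. y - y' = sm (fps_X ^ N) z - sm (fps_X ^ N) z'"
proof -
  let ?s = "\<Sum>\<nu><N. poly_op sm A (P \<nu>) (sm (fps_X ^ \<nu>) x)"
  obtain z z' where "y - ?s = sm (fps_X ^ N) z" "y' - ?s = sm (fps_X ^ N) z'"
    using assms unfolding atilde_lim_def by meson
  moreover have "y - y' = (y - ?s) - (y' - ?s)" by simp
  ultimately show ?thesis by metis
qed

lemma atilde_lim_unique_E:
  assumes "atilde_lim C smE A P x y" "atilde_lim C smE A P x y'"
  shows "y = y'"
proof (intro ext fps_ext)
  fix i n
  from atilde_lim_diff[OF assms, of "Suc n"] obtain z z'
    where "y - y' = smE (fps_X ^ Suc n) z - smE (fps_X ^ Suc n) z'" by blast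
  then have "(y - y') i $ n = (smE (fps_X ^ Suc n) z - smE (fps_X ^ Suc n) z') i $ n" by simp
  then show "y i $ n = y' i $ n"
    by (simp add: smE_def minus_apply fps_X_power_mult_nth del: power_Suc)
qed

lemma atilde_lim_unique_X:
  assumes "atilde_lim C smX A P x y" "atilde_lim C smX A P x y'"
  shows "y = y'"
proof (intro ext fps_ext)
  fix q i n
  from atilde_lim_diff[OF assms, of "Suc n"] obtain z z'
    where "y - y' = smX (fps_X ^ Suc n) z - smX (fps_X ^ Suc n) z'" by blast
  then have "(y - y') q i $ n = (smX (fps_X ^ Suc n) z - smX (fps_X ^ Suc n) z') q i $ n" by simp
  then show "y q i $ n = y' q i $ n"
    by (simp add: smX_def minus_apply fps_X_power_mult_nth del: power_Suc)
qed

text \<open>Since \<open>a\<close> preserves b^n \<open>E\<close>, the term of index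
  \<open>\<nu>\<close> lies in b^\<nu> \<open>E\<close>, so the coefficients of the partial sums
  stabilise.\<close>

lemma atilde_lim_exists: "\<exists>y. atilde_lim UNIV smE (aE M) P x y"
proof -
  define V where "V n = {x :: 'a \<Rightarrow> complex fps. \<forall>i. \<forall>k<n. x i $ k = 0}" for n
  have V_a: "aE M x \<in> V n" if "x \<in> V n" for x n
  proof -
    have "(\<Sum>j\<in>UNIV. x j * M j i) $ k = 0" if "k < n" for i k
      using that \<open>x \<in> V n\<close> by (simp add: fps_sum_nth fps_mult_nth V_def)
    moreover have "(fps_X ^ 2 * fps_deriv (x i)) $ k = 0" if "k < n" for i k
    proof (cases "k < 2")
      case False
      then have "Suc (k - 2) < n" using that by simp
      with \<open>x \<in> V n\<close> have "x i $ Suc (k - 2) = 0" by (simp add: V_def)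
      then show ?thesis by (simp add: fps_X_power_mult_nth)
    qed (simp add: fps_X_power_mult_nth)
    ultimately show ?thesis by (simp add: V_def aE_def)
  qed
  have V_poly: "poly_op smE (aE M) p x \<in> V n" if "x \<in> V n" for p x n
  proof -
    have it: "(aE M ^^ k) x \<in> V n" for k by (induction k) (use that V_a in auto)
    have sum: "(\<Sum>k\<in>A. g k) \<in> V n" if "\<And>k. g k \<in> V n" for A :: "nat set" and g
      by (induction A rule: infinite_finite_induct)
        (use that in \<open>auto simp: V_def pointwise_simps\<close>)
    have "smE (fps_const c) ((aE M ^^ k) x) \<in> V n" for c k
      using it[of k] by (simp add: V_def smE_def)
    then show ?thesis unfolding poly_op_def by (rule sum)
  qed
  define t where "t \<nu> = poly_op smE (aE M) (P \<nu>) (smE (fps_X ^ \<nu>) x)" for \<nu>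
  have t: "t \<nu> i $ k = 0" if "k < \<nu>" for \<nu> i k
  proof -
    have "smE (fps_X ^ \<nu>) x \<in> V \<nu>" by (simp add: V_def smE_def fps_X_power_mult_nth)
    from V_poly[OF this, of "P \<nu>"] that show ?thesis by (simp add: V_def t_def)
  qed
  define s where "s N = (\<Sum>\<nu><N. t \<nu>)" for N
  have stable: "s (Suc k + d) i $ k = s (Suc k) i $ k" for k d i
    by (induction d) (simp_all add: s_def pointwise_simps t)
  define y where "y i = Abs_fps (\<lambda>n. s (Suc n) i $ n)" for i
  have y: "(y - s N) i $ k = 0" if "k < N" for N i k
    using stable[of k "N - Suc k" i] that by (simp add: y_def pointwise_simps)
  have "y - s N = smE (fps_X ^ N) (\<lambda>i. fps_shift N ((y - s N) i))" for N
    unfolding smE_def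
    by (intro ext fps_ext) (simp add: fps_X_power_mult_nth y)
  then show ?thesis unfolding atilde_lim_def s_def t_def by blast
qed

lemma atilde_act_E: "atilde_lim UNIV smE (aE M) P x (atilde_act UNIV smE (aE M) P x)"
proof -
  have "\<exists>!y. atilde_lim UNIV smE (aE M) P x y"
    using atilde_lim_exists atilde_lim_unique_E by blast
  from theI'[OF this] show ?thesis unfolding atilde_act_def atilde_lim_def .
qed

lemma atilde_act_X:
  assumes "atilde_lim Xi smX A P x y"
  shows "atilde_act Xi smX A P x = y"
  unfolding atilde_act_def
proof (rule the_equality)
  show "y \<in> Xi \<and> (\<forall>N. \<exists>z\<in>Xi. y - (\<Sum>\<nu><N. poly_op smX A (P \<nu>) (smX (fps_X ^ \<nu>) x)) = smX (fps_X ^ N) z)"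
    using assms by (simp add: atilde_lim_def)
  fix y' assume "y' \<in> Xi \<and> (\<forall>N. \<exists>z\<in>Xi. y' - (\<Sum>\<nu><N. poly_op smX A (P \<nu>) (smX (fps_X ^ \<nu>) x)) = smX (fps_X ^ N) z)"
  then have "atilde_lim Xi smX A P x y'" by (simp add: atilde_lim_def)
  from atilde_lim_unique_X[OF this assms] show "y' = y" .
qed

text \<open>Commuting with \<open>b\<close>, \<open>f\<close> carries b-adic limits in
  \<open>E\<close> to limits in \<open>Xi\<close>. Hence it respects the whole action, and the image
  of a generator of \<open>E\<close> generates the image of \<open>E\<close>.\<close>

lemma themeI:
  assumes mono: "monogenic M" and inj: "inj f" and Xi: "\<And>x. f x \<in> Xi"
    and add: "\<And>x y. f (x + y) = f x + f y"
    and sm: "\<And>S x. f (smE S x) = smX S (f x)"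
    and a: "\<And>x. f (aE M x) = aX (f x)"
  shows "theme M"
proof -
  from mono obtain x where x: "atilde_span UNIV smE (aE M) x = UNIV" by (auto simp: monogenic_def)
  have f0: "f 0 = 0" using add[of 0 0] by simp
  have diff: "f (u - v) = f u - f v" for u v using add[of "u - v" v] by (simp add: eq_diff_eq)
  have sum: "f (\<Sum>k\<in>A. g k) = (\<Sum>k\<in>A. f (g k))" for A :: "nat set" and g
    by (induction A rule: infinite_finite_induct) (simp_all add: f0 add)
  have pow: "f ((aE M ^^ k) u) = (aX ^^ k) (f u)" for k u
    by (induction k) (simp_all add: a)
  have poly: "f (poly_op smE (aE M) p u) = poly_op smX aX p (f u)" for p u
    by (simp add: poly_op_def sum sm pow)
  have lim: "atilde_lim Xi smX aX P (f x) (f y)" if y: "atilde_lim UNIV smE (aE M) P x y" for P y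
    unfolding atilde_lim_def
  proof (intro conjI allI Xi)
    fix N
    from y obtain z where "y - (\<Sum>\<nu><N. poly_op smE (aE M) (P \<nu>) (smE (fps_X ^ \<nu>) x)) = smE (fps_X ^ N) z"
      unfolding atilde_lim_def by blast
    then have "f (y - (\<Sum>\<nu><N. poly_op smE (aE M) (P \<nu>) (smE (fps_X ^ \<nu>) x))) = smX (fps_X ^ N) (f z)"
      by (simp add: sm)
    then show "\<exists>z\<in>Xi. f y - (\<Sum>\<nu><N. poly_op smX aX (P \<nu>) (smX (fps_X ^ \<nu>) (f x))) = smX (fps_X ^ N) z"
      unfolding diff sum poly sm using Xi by blast
  qed
  have act: "atilde_act Xi smX aX P (f x) = f (atilde_act UNIV smE (aE M) P x)" for P
    by (rule atilde_act_X[OF lim[OF atilde_act_E]])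
  have "atilde_span Xi smX aX (f x) = f ` atilde_span UNIV smE (aE M) x"
    unfolding atilde_span_def act by blast
  then have "bij_betw f UNIV (atilde_span Xi smX aX (f x))"
    using inj x by (simp add: bij_betw_def)
  with add sm a Xi show ?thesis unfolding theme_def by blast
qed

lemma eigenvector_shift:
  assumes "binv_a M v = fls_const \<mu> *\<^sub>K v"
  shows "binv_a M (bpow n *\<^sub>K v) = fls_const (\<mu> + of_int n) *\<^sub>K bpow n *\<^sub>K v"
  by (simp add: binv_a_scale assms theta_bpow fls_vs.scale_left_distrib ring_distribs mult.commute
      flip: fls_plus_const)

text \<open>Absence of poles turns the Laurent coordinates of \<open>h\<close> on \<open>E\<close>
  into power series, which are the coefficients of the e_(l,j) in \<open>Xi\<close>.\<close>

lemma embedding_theme: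
  fixes M :: "'i::finite \<Rightarrow> 'i \<Rightarrow> complex fps"
  assumes mono: "monogenic M" and l: "0 < l" "l \<le> (1::rat)"
    and lin: "Vector_Spaces.linear fscale fscale (h :: ('i \<Rightarrow> complex fls) \<Rightarrow> nat \<Rightarrow> complex fls)"
    and hN: "\<And>x. h (binv_a M x) = log_op (of_rat l) (h x)"
    and inj: "\<And>x. h x = 0 \<Longrightarrow> x = 0" and J: "\<And>x j. j \<ge> J \<Longrightarrow> h x j = 0"
    and hol: "\<And>x. h (liftL x) \<in> val_ge 0"
  shows "theme M"
proof (rule themeI[OF mono])
  interpret h: Vector_Spaces.linear fscale fscale h by fact
  define g where "g x j = fls_regpart (h (liftL x) j)" for x j
  have g: "fps_to_fls (g x j) = h (liftL x) j" for x j
    unfolding g_def by (rule fls_eqI) (use hol[of x] in \<open>auto simp: val_ge_def\<close>)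
  have g_add: "g (x + y) j = g x j + g y j" for x y j
    by (simp add: g_def liftL_add h.add pointwise_simps)
  have g_sm: "g (smE S x) j = S * g x j" for S x j
  proof -
    have "fps_to_fls (g (smE S x) j) = fps_to_fls (S * g x j)"
      by (simp add: g liftL_smE h.scale pointwise_simps fls_times_fps_to_fls)
    then show ?thesis by (simp only: fps_to_fls_eq_iff)
  qed
  have g_a: "g (aE M x) j = fps_const (of_rat l) * fps_X * g x j + fps_X * g x (Suc j)
      + fps_X ^ 2 * fps_deriv (g x j)" for x j
  proof -
    have "fps_to_fls (g (aE M x) j) = fls_X * log_op (of_rat l) (h (liftL x)) j"
      by (simp add: g aL_liftL[symmetric] aL_eq h.scale hN pointwise_simps)
    also have "\<dots> = fps_to_fls (fps_const (of_rat l) * fps_X * g x j + fps_X * g x (Suc j)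
      + fps_X ^ 2 * fps_deriv (g x j))"
      by (simp add: log_op_def theta_def g fls_times_fps_to_fls fls_deriv_fps_to_fls[symmetric] power2_eq_square algebra_simps)
    finally show ?thesis by (simp only: fps_to_fls_eq_iff)
  qed
  \<comment> \<open>Only the exponent \<open>l\<close> occurs, so the image lies in the single
    summand of \<open>Xi\<close> belonging to \<open>l\<close>.\<close>
  define f where "f x = (\<lambda>q j. if q = l then g x j else 0)" for x
  show "inj f"
  proof (rule injI)
    fix x y assume eq: "f x = f y"
    have "g x j = g y j" for j using fun_cong[OF fun_cong[OF eq, of l], of j] by (simp add: f_def)
    then have "h (liftL x - liftL y) = 0"
      by (simp add: h.diff fun_eq_iff pointwise_simps flip: g)
    then show "x = y" using inj by (metis eq_iff_diff_eq_0 liftL_inject)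
  qed
  show "f x \<in> Xi" for x
  proof -
    have "g x j = 0" if "j \<ge> J" for j using J[OF that] by (simp add: g_def)
    then have "{(q, j). f x q j \<noteq> 0} \<subseteq> {l} \<times> {..<J}"
      by (auto simp: f_def not_less[symmetric] split: if_splits)
    then have "finite {(q, j). f x q j \<noteq> 0}" by (rule finite_subset) simp
    with l show ?thesis by (auto simp: Xi_def f_def)
  qed
  show "f (x + y) = f x + f y" for x y
    by (simp add: f_def g_add fun_eq_iff pointwise_simps)
  show "f (smE S x) = smX S (f x)" for S x
    by (simp add: f_def g_sm smX_def fun_eq_iff)
  show "f (aE M x) = aX (f x)" for x
    by (simp add: f_def g_a aX_def fun_eq_iff)
qed

section \<open>Primitivity and the theme structure from the single eigenline\<close>

theorem theorem3p7:
  fixes M :: "'i::finite \<Rightarrow> 'i \<Rightarrow> complex fps"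
  assumes "monogenic M"
    and "geometric M"
    and "\<exists>!F. is_ab_module smE (aE M) F \<and> free_of_rank smE F 1 \<and> normal_sub F"
  shows "\<exists>l::rat. 0 < l \<and> l \<le> 1 \<and> theme M \<and> primitive M l"
proof -
  have reg: "regular M" and neg: "\<And>z. poly (bernstein M) z = 0 \<Longrightarrow> \<exists>q::rat. q < 0 \<and> z = of_rat q"
    using assms(2) by (auto simp: geometric_def)
  from saturation_lattice[OF reg] obtain m
    where lat: "connection_lattice (binv_a M) (saturation M) m" by blast
  interpret connection_lattice "binv_a M" "saturation M" m by fact
  \<comment> \<open>With the zero subspace, \<open>S.eig\<close> speaks of the lattice modulo
    \<open>b\<close> itself, and \<open>S.eig_lift\<close> yields genuine eigenvectors.\<close>
  interpret S: connection_lattice_sub "binv_a M" "saturation M" m "{0}"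
    by unfold_locales (use T_0 in \<open>auto simp: T_def\<close>)
  have cong_iff: "S.cong n y \<longleftrightarrow> y \<in> bfilt n" for n y by (simp add: S.cong_def)
  note B = bernstein_minimal[OF lat]
  have B_annih: "annih (bernstein M)" using B(2) annihilates_iff[OF lat] by simp
  have eigenvector: "\<exists>n::nat. \<exists>v. v \<noteq> 0 \<and> binv_a M v = fls_const (- z - of_nat n) *\<^sub>K v"
    if "S.eig z" for z
  proof -
    from S.eig_lift[OF that] obtain n v
      where "v \<noteq> 0" and Tv: "T v - fls_const (z + of_nat n) *\<^sub>K v = 0" by auto
    have "binv_a M v = - T v" by (simp add: T_def)
    also have "\<dots> = fls_const (- z - of_nat n) *\<^sub>K v"
      using Tv by (simp add: fls_vs.scale_left_diff_distrib fls_vs.scale_left_distrib algebra_simps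
          flip: fls_minus_const fls_plus_const)
    finally show ?thesis using \<open>v \<noteq> 0\<close> by blast
  qed
  have "UNIV \<noteq> {0 :: 'i \<Rightarrow> complex fls}"
  proof
    assume "UNIV = {0 :: 'i \<Rightarrow> complex fls}"
    then have "(\<lambda>_. 1) = (0 :: 'i \<Rightarrow> complex fls)" by blast
    then show False by (auto simp: fun_eq_iff pointwise_simps)
  qed
  then obtain z0 where "S.eig z0" using S.eig_exists by metis
  from eigenvector[OF this] obtain v \<mu> where v: "v \<noteq> 0" "binv_a M v = fls_const \<mu> *\<^sub>K v" by blast

  text \<open>Rescaled by a power of \<open>b\<close>, the eigenvector is nonzero modulo \<open>b\<close>, so its eigenvalue is read off
    the Bernstein polynomial.\<close>
  have "\<exists>q::rat. \<mu> = of_rat q"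
  proof -
    obtain k where k: "v \<in> val_ge (- int k)" using val_ge_exists by blast
    define u where "u = bpow (int k) *\<^sub>K v"
    have u: "u \<in> saturation M" "u \<noteq> 0" using k v Lam_lower by (auto simp: u_def subset_iff)
    have "\<exists>n. u \<notin> bfilt n"
    proof (rule ccontr)
      assume "\<not> ?thesis"
      then have "u \<in> val_ge (int d)" for d using bfilt_upper[of u "d + m"] by simp
      then have "u = 0" by (rule val_ge_all_eq_0)
      with u(2) show False by simp
    qed
    moreover have "u \<in> bfilt 0" using u(1) by simp
    ultimately obtain n where n: "u \<in> bfilt n" "u \<notin> bfilt (Suc n)"
      using nat_induct[of "\<lambda>n. u \<in> bfilt n"] by blast
    define w where "w = bpow (int k - int n) *\<^sub>K v"
    have w_eq: "w = bpow (- int n) *\<^sub>K u" by (simp add: w_def u_def bpow_add)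
    have wL: "w \<in> saturation M" using n(1) by (simp add: w_eq bfilt_def)
    have "w \<notin> bfilt 1" using n(2) by (simp add: w_eq bfilt_def bpow_add)
    define \<nu> where "\<nu> = \<mu> + of_int (int k - int n)"
    have "binv_a M w = fls_const \<nu> *\<^sub>K w"
      unfolding w_def \<nu>_def by (rule eigenvector_shift[OF v(2)])
    then have "T w - fls_const (- \<nu>) *\<^sub>K w = 0" by (simp add: T_def)
    with wL \<open>w \<notin> bfilt 1\<close> have "S.eig (- \<nu>)"
      unfolding S.eig_def cong_iff using bfilt_0_mem by metis
    from neg[OF S.eig_root[OF this B_annih]] obtain q :: rat where "- \<nu> = of_rat q" by blast
    then have "\<mu> = of_rat (- q - of_int (int k - int n))"
      by (simp add: \<nu>_def of_rat_add of_rat_diff of_rat_minus algebra_simps)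
    then show ?thesis by blast
  qed
  then obtain q :: rat where q: "\<mu> = of_rat q" by blast
  \<comment> \<open>The integer shift that moves \<open>q\<close> into ]0,1]; the ceiling fits
    because the interval is closed on the right.\<close>
  define s where "s = 1 - \<lceil>q\<rceil>"
  define l where "l = q + of_int s"
  have l: "0 < l" "l \<le> 1" unfolding l_def s_def by (simp_all, linarith+)
  define w0 where "w0 = bpow s *\<^sub>K v"
  have w0: "w0 \<noteq> 0" "binv_a M w0 = fls_const (of_rat l) *\<^sub>K w0"
    using v(1) eigenvector_shift[OF v(2), of s] by (auto simp: w0_def l_def q of_rat_add)
  interpret E: single_eigenline "binv_a M" "saturation M" m w0 "of_rat l"
    by unfold_locales (use w0 eigenvectors_proportional[OF assms(3) _ _ w0] in auto)

  have "primitive M l"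
    unfolding primitive_def
  proof (intro conjI allI impI reg)
    fix z assume "poly (bernstein M) z = 0"
    \<comment> \<open>The cofactor \<open>p\<close> of a root \<open>z\<close> has smaller degree
      than the minimal annihilator, so it fails to kill some \<open>y\<close>; its value at
      \<open>y\<close> is an eigenvector for \<open>z\<close> modulo \<open>b\<close>.\<close>
    then obtain p where p: "bernstein M = [:- z, 1:] * p" by (metis dvdE poly_eq_0_iff_dvd)
    have "bernstein M \<noteq> 0" using B(1) by auto
    then have "p \<noteq> 0" using p by auto
    have "\<not> annih p"
    proof
      assume "annih p"
      then have "bernstein M dvd p" using B(3) annihilates_iff[OF lat] by simp
      with \<open>p \<noteq> 0\<close> have "degree (bernstein M) \<le> degree p" by (rule dvd_imp_degree_le[rotated])
      then show False using \<open>p \<noteq> 0\<close> unfolding p by (subst (asm) degree_mult_eq) auto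
    qed
    then obtain y where y: "y \<in> saturation M" "pact p y \<notin> bfilt 1" by (auto simp: annih_def)
    have "T (pact p y) - fls_const z *\<^sub>K pact p y \<in> bfilt 1"
      using B_annih y(1) unfolding annih_def p pact_mult pact_linear_factor by blast
    then have "S.eig z" unfolding S.eig_def cong_iff using y Lam_pact by blast
    from eigenvector[OF this] obtain n :: nat and x
      where x: "x \<noteq> 0" "binv_a M x = fls_const (- z - of_nat n) *\<^sub>K x" by blast
    from E.proportional[OF x] obtain c where c: "x = c *\<^sub>K w0" by blast
    \<comment> \<open>Compare eigenvalues of x = c w0: a nonzero coefficient of \<open>c\<close> at
      b^k forces the eigenvalue of \<open>x\<close> to be l + k, an integer translate of
      \<open>l\<close>.\<close>
    have "(c * fls_const (of_rat l) + theta c) *\<^sub>K w0 = (fls_const (- z - of_nat n) * c) *\<^sub>K w0"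
      using x(2) unfolding c binv_a_scale w0(2) by (simp add: fls_vs.scale_left_distrib)
    then have eq: "c * fls_const (of_rat l) + theta c = fls_const (- z - of_nat n) * c"
      using w0(1) by (metis fls_vs.scale_cancel_right)
    have "c \<noteq> 0" using x(1) c by auto
    then obtain k where k: "c $$ k \<noteq> 0" by (metis fls_nonzero_nth)
    have "(c * fls_const (of_rat l) + theta c) $$ k = (fls_const (- z - of_nat n) * c) $$ k"
      by (simp only: eq)
    then have "(of_rat l + of_int k - (- z - of_nat n)) * c $$ k = 0"
      by (simp add: algebra_simps)
    then have "of_rat l + of_int k - (- z - of_nat n) = 0" using k by simp
    then have "z = - of_rat l + of_int (- k - int n)"
      by (simp add: algebra_simps eq_neg_iff_add_eq_0)
    then show "\<exists>k::int. z = - of_rat l + of_int k" by blast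
  qed

  moreover have "theme M"
  proof -
    obtain h where h: "E.embeds UNIV h" using E.embeds_UNIV by blast
    then obtain J where hp: "Vector_Spaces.linear fscale fscale h"
      "\<And>x. h (binv_a M x) = log_op (of_rat l) (h x)" "\<And>x. h x = 0 \<Longrightarrow> x = 0"
      "\<And>x j. j \<ge> J \<Longrightarrow> h x j = 0"
      unfolding E.embeds_def by blast
    \<comment> \<open>Here the negativity of the Bernstein roots and the bound l \<le> 1 combine: D
      - l is nonnegative as soon as \<open>D\<close> is positive.\<close>
    have "poly (bernstein M) (of_nat D - of_rat l) \<noteq> 0" if "D > 0" for D :: nat
    proof
      assume "poly (bernstein M) (of_nat D - of_rat l) = 0"
      from neg[OF this] obtain r :: rat where r: "r < 0" "of_nat D - of_rat l = (of_rat r :: complex)"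
        by blast
      have "(of_rat (of_nat D - l) :: complex) = of_rat r" using r(2) by (simp add: of_rat_diff)
      then have "of_nat D - l = r" by simp
      moreover have "(1::rat) \<le> of_nat D" using that by simp
      ultimately show False using r(1) l(2) by linarith
    qed
    note no_poles = E.embedding_no_poles[OF h B_annih this]
    have "liftL x \<in> saturation M" for x using Lam_lower by (auto simp: val_ge_0_eq)
    then have "h (liftL x) \<in> val_ge 0" for x by (intro no_poles)
    with embedding_theme[OF assms(1) l hp] show ?thesis by blast
  qed
  ultimately show ?thesis using l by blast
qed

end
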